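(* Suppose that $G$ is a graph for which there exists a partition $\{S_1, \ldots, S_m\}$ of $V(G)$ such that for each $i$, $|S_i| \geq 3$ and the induced subgraph $G[S_i]$ is an odd cycle or a complete graph. For each $i \geq 2$ suppose each vertex in $S_i$ has at most $\rho_i$ neighbors in $\bigcup_{j=1}^{i-1} S_j$, and let $\rho_1=0$. For each $i \geq 1$ let $$\alpha_i = \begin{cases} \rho_i+3 & \text{if } G[S_i] \text{ is an odd cycle,} \\ \rho_i + |S_i| & \text{if } G[S_i] \text{ is a complete graph,} \end{cases}$$ and let $\alpha = \max_{i} \alpha_i$. Suppose $H$ is a graph on at least two vertices that contains a Hamilton path $w_1, w_2, \ldots, w_n$ such that, for each $i$, $w_i$ has at most $k$ neighbors (in $H$) among $w_1, \ldots, w_{i-1}$. Then $AT(G) \leq \alpha$ and $AT(G \square H) \leq \alpha+k-1$.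
   Context: All graphs are finite and simple, and digraphs are simple. $G[T]$ denotes the subgraph of $G$ induced by $T\subseteq V(G)$. A Hamilton path $w_1,\ldots,w_n$ of $H$ is a listing of all vertices of $H$, each exactly once, with consecutive vertices adjacent in $H$. The Cartesian product $G \square H$ has vertex set $V(G)\times V(H)$, with $(u,v)$ adjacent to $(u',v')$ iff either $u=u'$ and $vv'\in E(H)$, or $v=v'$ and $uu'\in E(G)$. A circulation contained in a digraph $D$ is a spanning subdigraph $E$ of $D$ such that $d^-_E(v)=d^+_E(v)$ (indegree equals outdegree in $E$) for every $v\in V(D)$; it is even (resp. odd) if it has an even (resp. odd) number of edges (the edgeless circulation is even). The Alon-Tarsi number $AT(G)$ is the smallest $k$ for which there is an orientation $D$ of $G$ with maximum indegree $k-1$ such that the number of even circulations and the number of odd circulations contained in $D$ are different. (When $|S_i|=3$ and $G[S_i]$ is a triangle, the two cases in the definition of $\alpha_i$ agree.) *)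

theory Defs
  imports "Graph_Theory.Graph_Theory" "HOL-Library.Disjoint_Sets"
begin

text \<open>
  Finite simple graphs are the symmetric, loop-free, finite digraphs \<^locale>\<open>pair_graph\<close>: an edge
  \<open>uv\<close> is the pair of arcs \<open>(u, v)\<close>, \<open>(v, u)\<close>.
\<close>

definition neighborhood :: "'a pair_pre_digraph \<Rightarrow> 'a \<Rightarrow> 'a set" where
  "neighborhood G v = {u. (u, v) \<in> parcs G}"

text \<open>An odd cycle as a whole graph: there are no vertices off the cycle and no chords.\<close>

definition odd_cycle_graph :: "('a, 'b) pre_digraph \<Rightarrow> bool" where
  "odd_cycle_graph C \<longleftrightarrow> graph C \<and>
     (\<exists>vs. distinct vs \<and> 3 \<le> length vs \<and> odd (length vs) \<and> verts C = set vs \<and>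
       (let A = set (vwalk_arcs (vs @ [hd vs])) in arcs_ends C = A \<union> A\<inverse>))"

definition complete_graph :: "('a, 'b) pre_digraph \<Rightarrow> bool" where
  "complete_graph C \<longleftrightarrow> (\<exists>n. complete_digraph n C)"

definition hamilton_path :: "'a list \<Rightarrow> 'a pair_pre_digraph \<Rightarrow> bool" where
  "hamilton_path ws H \<longleftrightarrow> vpath ws (with_proj H) \<and> set ws = pverts H"

definition cartesian_product ::
    "'a pair_pre_digraph \<Rightarrow> 'b pair_pre_digraph \<Rightarrow> ('a \<times> 'b) pair_pre_digraph" (infixl \<open>\<box>\<close> 70) where
  "G \<box> H = \<lparr> pverts = pverts G \<times> pverts H,
     parcs = {((u, v), (u', v')) | u v u' v'.
        (u, v) \<in> pverts G \<times> pverts H \<and> (u', v') \<in> pverts G \<times> pverts H \<and>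
        (u = u' \<and> (v, v') \<in> parcs H \<or> v = v' \<and> (u, u') \<in> parcs G)} \<rparr>"

definition orientation :: "'a pair_pre_digraph \<Rightarrow> 'a pair_pre_digraph \<Rightarrow> bool" where
  "orientation D G \<longleftrightarrow> pverts D = pverts G \<and>
     parcs D \<union> (parcs D)\<inverse> = parcs G \<and> parcs D \<inter> (parcs D)\<inverse> = {}"

definition circulation :: "'a pair_pre_digraph \<Rightarrow> 'a pair_pre_digraph \<Rightarrow> bool" where
  "circulation E D \<longleftrightarrow> spanning (with_proj E) (with_proj D) \<and>
     (\<forall>v \<in> pverts D. in_degree (with_proj E) v = out_degree (with_proj E) v)"

definition even_circulations :: "'a pair_pre_digraph \<Rightarrow> 'a pair_pre_digraph set" where
  "even_circulations D = {E. circulation E D \<and> even (card (parcs E))}"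

definition odd_circulations :: "'a pair_pre_digraph \<Rightarrow> 'a pair_pre_digraph set" where
  "odd_circulations D = {E. circulation E D \<and> odd (card (parcs E))}"

text \<open>Meaningful for digraphs with at least one vertex.\<close>

definition max_in_degree :: "'a pair_pre_digraph \<Rightarrow> nat" where
  "max_in_degree D = Max (in_degree (with_proj D) ` pverts D)"

text \<open>
  \<open>max_in_degree D + 1 = k\<close> rather than \<open>max_in_degree D = k - 1\<close>, since subtraction on \<^typ>\<open>nat\<close>
  would admit \<open>k = 0\<close> for edgeless graphs.
\<close>

definition AT :: "'a pair_pre_digraph \<Rightarrow> nat" where
  "AT G = (LEAST k. \<exists>D. orientation D G \<and> max_in_degree D + 1 = k \<and>
             card (even_circulations D) \<noteq> card (odd_circulations D))"

end

theory Submission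
  imports Defs
begin

text \<open>
  Reversing an arc set \<open>F\<close> of an orientation \<open>R\<close> changes indegrees by the net outflow of \<open>F\<close>, so the
  orientations of a graph with prescribed indegrees are the flows in \<open>R\<close> with a prescribed boundary
  \<open>e\<close>. If their signed count is nonzero, then reversing one of them gives an orientation with these
  indegrees whose even and odd circulations differ in number. Signed counts are multiplicative along
  vertex partitions in which all arcs between different parts point forward.

  All but three vertices of a complete graph can be split off as parts of their own, which leaves odd
  cycles \<open>C\<close>. In \<open>C \<box> H\<close> take \<open>R\<close> to be a directed cycle on every layer together with all edges of
  \<open>H\<close> directed forward along the Hamilton path, and count unit flows from the first to the last layer.
  A layer without boundary that the flow avoids contributes the factor \<open>1 - 1 = 0\<close>, as its cycle is odd,
  so all \<open>n\<close> layers are visited and the count is up to sign an entry of \<open>M\<^sup>n\<close>, where \<open>M u v\<close> counts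
  the unit flows in \<open>C\<close> from \<open>u\<close> to \<open>v\<close>. Complementation in the odd cycle shows that \<open>M\<close> is
  skew-symmetric, so \<open>M\<^sup>n \<noteq> 0\<close>.
\<close>

section \<open>Signed flow counts\<close>

text \<open>The excess of outdegree over indegree at \<open>v\<close>. Written as a sum over arcs,
  it is additive in \<open>F\<close>, and summing it over a vertex set leaves only boundary
  arcs.\<close>

definition net :: "('a \<times> 'a) set \<Rightarrow> 'a \<Rightarrow> int" where
  "net F v = (\<Sum>a\<in>F. of_bool (fst a = v) - of_bool (snd a = v))"

text \<open>
  Up to sign, \<open>flow_count V R e\<close> is the coefficient in the graph polynomial of \<open>R\<close> of the monomial
  whose exponent at \<open>v\<close> is the indegree of \<open>v\<close> in \<open>R\<close> plus \<open>e v\<close>.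
\<close>

definition flow_count :: "'a set \<Rightarrow> ('a \<times> 'a) set \<Rightarrow> ('a \<Rightarrow> int) \<Rightarrow> int" where
  "flow_count V R e =
     (\<Sum>F\<in>Pow (R \<inter> V \<times> V). of_bool (\<forall>v\<in>V. net F v = e v) * (- 1) ^ card F)"

lemma net_empty [simp]: "net {} v = 0"
  by (simp add: net_def)

lemma net_insert:
  "finite F \<Longrightarrow> a \<notin> F \<Longrightarrow>
    net (insert a F) v = of_bool (fst a = v) - of_bool (snd a = v) + net F v"
  by (simp add: net_def)

lemma net_singleton [simp]: "net {a} v = of_bool (fst a = v) - of_bool (snd a = v)"
  by (simp add: net_def)

lemma net_Un: "finite F \<Longrightarrow> finite F' \<Longrightarrow> F \<inter> F' = {} \<Longrightarrow> net (F \<union> F') v = net F v + net F' v"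
  by (simp add: net_def sum.union_disjoint)

lemma net_outside: "F \<subseteq> A \<times> A \<Longrightarrow> v \<notin> A \<Longrightarrow> net F v = 0"
  unfolding net_def by (rule sum.neutral) fastforce

lemma net_eq_card:
  assumes "finite F"
  shows "net F v = int (card {u. (v, u) \<in> F}) - int (card {u. (u, v) \<in> F})"
proof -
  have "{a \<in> F. fst a = v} = Pair v ` {u. (v, u) \<in> F}"
    and "{a \<in> F. snd a = v} = (\<lambda>u. (u, v)) ` {u. (u, v) \<in> F}" by force+
  then have "card {a \<in> F. fst a = v} = card {u. (v, u) \<in> F}"
    and "card {a \<in> F. snd a = v} = card {u. (u, v) \<in> F}" by (simp_all add: card_image inj_on_def)
  then show ?thesis
    using assms by (simp add: net_def sum_subtractf of_bool_def flip: sum.inter_filter)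
qed

text \<open>After exchanging the two sums, only arcs leaving or entering \<open>A\<close>
  contribute, with values 1 and -1 respectively.\<close>

lemma sum_net:
  assumes "finite A"
  shows "(\<Sum>v\<in>A. net F v) = (\<Sum>a\<in>F. of_bool (fst a \<in> A) - of_bool (snd a \<in> A))"
proof -
  have "(\<Sum>v\<in>A. net F v) = (\<Sum>a\<in>F. \<Sum>v\<in>A. of_bool (fst a = v) - of_bool (snd a = v))"
    unfolding net_def by (rule sum.swap)
  also have "\<dots> = (\<Sum>a\<in>F. of_bool (fst a \<in> A) - of_bool (snd a \<in> A))"
    using assms by (intro sum.cong refl) (simp add: sum_subtractf of_bool_def)
  finally show ?thesis .
qed

lemma flow_count_empty [simp]: "flow_count {} R e = 1"
  by (simp add: flow_count_def)

lemma flow_count_cong: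
  "(\<And>v. v \<in> V \<Longrightarrow> e v = e' v) \<Longrightarrow> R \<inter> V \<times> V = R' \<inter> V \<times> V \<Longrightarrow>
    flow_count V R e = flow_count V R' e'"
  unfolding flow_count_def by simp

lemma flow_count_nonzeroE:
  assumes "flow_count V R e \<noteq> 0"
  obtains F where "F \<subseteq> R \<inter> V \<times> V" "\<And>v. v \<in> V \<Longrightarrow> net F v = e v"
proof -
  obtain F where "F \<in> Pow (R \<inter> V \<times> V)" "of_bool (\<forall>v\<in>V. net F v = e v) * (- 1) ^ card F \<noteq> (0 :: int)"
    using assms unfolding flow_count_def by (meson sum.not_neutral_contains_not_neutral)
  then show ?thesis using that by (auto split: if_splits)
qed

text \<open>Inside \<open>V\<close> every arc leaves one vertex and enters another place of
  \<open>V\<close>, so net outflows cancel in total and no flow attains a boundary with nonzero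
  sum.\<close>

lemma flow_count_nonzero_sum:
  assumes "finite V" "flow_count V R e \<noteq> 0"
  shows "sum e V = 0"
proof -
  obtain F where F: "F \<subseteq> R \<inter> V \<times> V" "\<And>v. v \<in> V \<Longrightarrow> net F v = e v"
    using flow_count_nonzeroE[OF assms(2)] by metis
  have "sum e V = (\<Sum>v\<in>V. net F v)" using F by simp
  also have "\<dots> = 0" unfolding sum_net[OF assms(1)] using F by (intro sum.neutral) auto
  finally show ?thesis .
qed

lemma sum_Pow_Un:
  assumes "P \<inter> Q = {}"
  shows "(\<Sum>F\<in>Pow (P \<union> Q). f F) = (\<Sum>X\<in>Pow P. \<Sum>Y\<in>Pow Q. f (X \<union> Y))"
proof -
  have "(\<Sum>F\<in>Pow (P \<union> Q). f F) = (\<Sum>(X, Y)\<in>Pow P \<times> Pow Q. f (X \<union> Y))"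
    by (rule sum.reindex_bij_witness[of _ "\<lambda>(X, Y). X \<union> Y" "\<lambda>F. (F \<inter> P, F \<inter> Q)"])
      (use assms in \<open>auto simp flip: Int_Un_distrib simp: Int_absorb2\<close>)
  then show ?thesis by (simp add: sum.cartesian_product)
qed

section \<open>Splitting flow counts along a vertex partition\<close>

text \<open>An arc set on \<open>A \<union> B\<close> consists of crossing arcs \<open>X\<close> and
  parts inside \<open>A\<close> and inside \<open>B\<close>. Once \<open>X\<close> is fixed, the two
  inner parts are chosen independently, each with the boundary corrected by
  \<open>net X\<close>.\<close>

lemma flow_count_Un:
  assumes fin: "finite A" "finite B" and AB: "A \<inter> B = {}"
  shows "flow_count (A \<union> B) R e = (\<Sum>X\<in>Pow (R \<inter> (A \<times> B \<union> B \<times> A)). (- 1) ^ card X *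
     (flow_count A R (\<lambda>v. e v - net X v) * flow_count B R (\<lambda>v. e v - net X v)))"
proof -
  define P where "P = R \<inter> A \<times> A"
  define Q where "Q = R \<inter> B \<times> B"
  define X0 where "X0 = R \<inter> (A \<times> B \<union> B \<times> A)"
  define g where "g F = (of_bool (\<forall>v\<in>A \<union> B. net F v = e v) * (- 1) ^ card F :: int)" for F
  have "P \<subseteq> A \<times> A" "Q \<subseteq> B \<times> B" "X0 \<subseteq> (A \<union> B) \<times> (A \<union> B)" by (auto simp: P_def Q_def X0_def)
  then have finP: "finite P" and finQ: "finite Q" and finX: "finite X0"
    using fin by (meson finite_SigmaI finite_UnI finite_subset)+
  have disj: "X0 \<inter> (P \<union> Q) = {}" "P \<inter> Q = {}" using AB by (auto simp: P_def Q_def X0_def)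
  have R: "R \<inter> (A \<union> B) \<times> (A \<union> B) = X0 \<union> (P \<union> Q)" by (auto simp: P_def Q_def X0_def)
  have g: "g (X \<union> (Y \<union> Z)) = (- 1) ^ card X *
      ((of_bool (\<forall>v\<in>A. net Y v = e v - net X v) * (- 1) ^ card Y) *
       (of_bool (\<forall>v\<in>B. net Z v = e v - net X v) * (- 1) ^ card Z))"
    if "X \<subseteq> X0" "Y \<subseteq> P" "Z \<subseteq> Q" for X Y Z
  proof -
    have f: "finite X" "finite Y" "finite Z"
      using that finP finQ finX by (auto intro: finite_subset)
    have d: "Y \<inter> Z = {}" "X \<inter> (Y \<union> Z) = {}" using that disj by auto
    have c: "card (X \<union> (Y \<union> Z)) = card X + (card Y + card Z)"
      using f d by (simp add: card_Un_disjoint)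
    have n: "net (X \<union> (Y \<union> Z)) v = net X v + (net Y v + net Z v)" for v
      using f d by (simp add: net_Un)
    have "net Y v = 0" if "v \<in> B" for v
      using that \<open>Y \<subseteq> P\<close> AB by (intro net_outside[of _ A]) (auto simp: P_def)
    moreover have "net Z v = 0" if "v \<in> A" for v
      using that \<open>Z \<subseteq> Q\<close> AB by (intro net_outside[of _ B]) (auto simp: Q_def)
    ultimately have "(\<forall>v\<in>A \<union> B. net (X \<union> (Y \<union> Z)) v = e v) \<longleftrightarrow>
        (\<forall>v\<in>A. net Y v = e v - net X v) \<and> (\<forall>v\<in>B. net Z v = e v - net X v)"
      unfolding n by (simp add: ball_Un algebra_simps)
    then show ?thesis unfolding g_def c by (simp only: of_bool_conj power_add) (simp add: algebra_simps)
  qed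
  have "flow_count (A \<union> B) R e = (\<Sum>X\<in>Pow X0. \<Sum>Y\<in>Pow P. \<Sum>Z\<in>Pow Q. g (X \<union> (Y \<union> Z)))"
    unfolding flow_count_def R g_def[symmetric]
    by (simp only: sum_Pow_Un[OF disj(1)] sum_Pow_Un[OF disj(2)])
  also have "\<dots> = (\<Sum>X\<in>Pow X0. (- 1) ^ card X *
     (flow_count A R (\<lambda>v. e v - net X v) * flow_count B R (\<lambda>v. e v - net X v)))"
    unfolding flow_count_def P_def[symmetric] Q_def[symmetric] sum_product
    unfolding sum_distrib_left by (intro sum.cong refl) (simp only: Pow_iff g)
  finally show ?thesis unfolding X0_def .
qed

text \<open>The corrected boundary must sum to 0 on \<open>B\<close>. As all crossing arcs point
  into \<open>B\<close>, each arc of \<open>X\<close> contributes exactly -1 to the net outflow of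
  \<open>B\<close>.\<close>

lemma flow_count_crossing:
  assumes fin: "finite A" "finite B" and AB: "A \<inter> B = {}" and BA: "R \<inter> B \<times> A = {}"
    and X: "X \<subseteq> R \<inter> (A \<times> B \<union> B \<times> A)" and nz: "flow_count B R (\<lambda>v. e v - net X v) \<noteq> 0"
  shows "int (card X) = - sum e B"
proof -
  have "0 = (\<Sum>v\<in>B. e v - net X v)" using flow_count_nonzero_sum[OF fin(2) nz] by simp
  also have "\<dots> = sum e B - (\<Sum>a\<in>X. of_bool (fst a \<in> B) - of_bool (snd a \<in> B))"
    by (simp add: sum_subtractf sum_net fin)
  also have "(\<Sum>a\<in>X. of_bool (fst a \<in> B) - of_bool (snd a \<in> B)) = (\<Sum>a\<in>X. - 1 :: int)"
  proof (rule sum.cong[OF refl])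
    fix a assume "a \<in> X"
    then have "a \<in> A \<times> B" using X BA by blast
    then have "fst a \<in> A" "snd a \<in> B" by auto
    then show "of_bool (fst a \<in> B) - of_bool (snd a \<in> B) = (- 1 :: int)" using AB by auto
  qed
  finally show ?thesis by simp
qed

text \<open>By \<open>flow_count_crossing\<close> no crossing arc can be used, so only the summand
  \<open>X = {}\<close> of \<open>flow_count_Un\<close> survives.\<close>

lemma flow_count_glue:
  assumes fin: "finite A" "finite B" and AB: "A \<inter> B = {}" and BA: "R \<inter> B \<times> A = {}"
    and e: "sum e B = 0"
  shows "flow_count (A \<union> B) R e = flow_count A R e * flow_count B R e"
proof -
  define X0 where "X0 = R \<inter> (A \<times> B \<union> B \<times> A)"
  have "X0 \<subseteq> (A \<union> B) \<times> (A \<union> B)" by (auto simp: X0_def)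
  then have finX: "finite X0" using fin by (meson finite_SigmaI finite_UnI finite_subset)
  have "flow_count B R (\<lambda>v. e v - net X v) = 0" if "X \<in> Pow X0 - {{}}" for X
  proof (rule ccontr)
    assume "flow_count B R (\<lambda>v. e v - net X v) \<noteq> 0"
    then have "card X = 0" using flow_count_crossing[OF fin AB BA, of X e] that e by (simp add: X0_def)
    with that finX show False by (auto dest: finite_subset)
  qed
  then have "flow_count (A \<union> B) R e = (\<Sum>X\<in>{{}}. (- 1) ^ card X *
     (flow_count A R (\<lambda>v. e v - net X v) * flow_count B R (\<lambda>v. e v - net X v)))"
    unfolding flow_count_Un[OF fin AB] X0_def[symmetric]
    by (intro sum.mono_neutral_right) (use finX in auto)
  then show ?thesis by simp
qed

text \<open>Here \<open>flow_count_crossing\<close> forces exactly one crossing arc, whose sign is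
  the leading minus.\<close>

lemma flow_count_glue_one:
  assumes fin: "finite A" "finite B" and AB: "A \<inter> B = {}" and BA: "R \<inter> B \<times> A = {}"
    and e: "sum e B = - 1"
  shows "flow_count (A \<union> B) R e = - (\<Sum>a\<in>R \<inter> A \<times> B.
     flow_count A R (\<lambda>v. e v - of_bool (fst a = v)) * flow_count B R (\<lambda>v. e v + of_bool (snd a = v)))"
proof -
  define X0 where "X0 = R \<inter> (A \<times> B \<union> B \<times> A)"
  have X0: "X0 = R \<inter> A \<times> B" using BA by (auto simp: X0_def)
  then have finX: "finite X0" using fin by (simp add: finite_subset)
  let ?f = "\<lambda>X. (- 1) ^ card X *
     (flow_count A R (\<lambda>v. e v - net X v) * flow_count B R (\<lambda>v. e v - net X v))"
  have "flow_count B R (\<lambda>v. e v - net X v) = 0" if "X \<in> Pow X0 - (\<lambda>a. {a}) ` X0" for X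
  proof (rule ccontr)
    assume "flow_count B R (\<lambda>v. e v - net X v) \<noteq> 0"
    then have "card X = 1" using flow_count_crossing[OF fin AB BA, of X e] that e by (simp add: X0_def)
    with that show False by (auto simp: card_1_singleton_iff)
  qed
  then have "flow_count (A \<union> B) R e = sum ?f ((\<lambda>a. {a}) ` X0)"
    unfolding flow_count_Un[OF fin AB] X0_def[symmetric]
    by (intro sum.mono_neutral_right) (use finX in auto)
  also have "\<dots> = (\<Sum>a\<in>X0. ?f {a})" by (simp add: sum.reindex inj_on_def)
  also have "\<dots> = (\<Sum>a\<in>X0. - (flow_count A R (\<lambda>v. e v - of_bool (fst a = v)) *
      flow_count B R (\<lambda>v. e v + of_bool (snd a = v))))"
  proof (intro sum.cong refl)
    fix a assume a: "a \<in> X0"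
    have "flow_count A R (\<lambda>v. e v - net {a} v) = flow_count A R (\<lambda>v. e v - of_bool (fst a = v))"
      by (rule flow_count_cong) (use a AB X0 in auto)
    moreover have "flow_count B R (\<lambda>v. e v - net {a} v) = flow_count B R (\<lambda>v. e v + of_bool (snd a = v))"
      by (rule flow_count_cong) (use a AB X0 in auto)
    ultimately show "?f {a} = - (flow_count A R (\<lambda>v. e v - of_bool (fst a = v)) *
      flow_count B R (\<lambda>v. e v + of_bool (snd a = v)))" by simp
  qed
  finally show ?thesis by (simp add: sum_negf X0)
qed

section \<open>Insertion, reversal and complementation of arcs\<close>

text \<open>Flows are sorted by whether they use \<open>a\<close>; using it costs one sign and
  leaves the boundary reduced by \<open>net {a}\<close> to the other arcs.\<close>

lemma flow_count_insert:
  assumes fin: "finite V" and a: "a \<in> V \<times> V" "a \<notin> R"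
  shows "flow_count V (insert a R) e = flow_count V R e - flow_count V R (\<lambda>v. e v - net {a} v)"
proof -
  let ?P = "R \<inter> V \<times> V"
  have finP: "finite ?P" using fin by simp
  have ins: "insert a R \<inter> V \<times> V = {a} \<union> ?P" and disj: "{a} \<inter> ?P = {}" using a by auto
  let ?g = "\<lambda>F. of_bool (\<forall>v\<in>V. net F v = e v) * (- 1) ^ card F :: int"
  have g: "?g ({a} \<union> F) = - (of_bool (\<forall>v\<in>V. net F v = e v - net {a} v) * (- 1) ^ card F)"
    if "F \<in> Pow ?P" for F
  proof -
    have F: "finite F" "a \<notin> F" using that finP disj by (auto intro: finite_subset[of _ ?P])
    have "net ({a} \<union> F) v = e v \<longleftrightarrow> net F v = e v - net {a} v" for v
      using F by (auto simp: net_insert)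
    then show ?thesis using F by simp
  qed
  have "flow_count V (insert a R) e = (\<Sum>F\<in>Pow ?P. ?g F) + (\<Sum>F\<in>Pow ?P. ?g ({a} \<union> F))"
    unfolding flow_count_def ins by (simp add: sum_Pow_Un[OF disj] Pow_insert del: Pow_Int_eq Un_insert_left)
  also have "\<dots> = flow_count V R e - flow_count V R (\<lambda>v. e v - net {a} v)"
    unfolding flow_count_def using g by (simp add: sum_negf)
  finally show ?thesis .
qed

text \<open>Induction over the arcs of \<open>F\<close>. By \<open>flow_count_insert\<close>, an arc
  and its reverse yield the same two counts, subtracted in opposite order, so each reversal
  contributes one sign.\<close>

lemma flow_count_flip:
  assumes fin: "finite V" and R: "R \<subseteq> V \<times> V" "R \<inter> R\<inverse> = {}" and F: "F \<subseteq> R"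
  shows "flow_count V (R - F \<union> F\<inverse>) (\<lambda>v. e v - net F v) = (- 1) ^ card F * flow_count V R e"
proof -
  have "finite R" using fin R by (meson finite_SigmaI finite_subset)
  then have "finite F" using F finite_subset by blast
  then show ?thesis using F
  proof (induction F)
    case empty
    then show ?case by simp
  next
    case (insert a F)
    let ?P = "R - insert a F \<union> F\<inverse>" and ?b = "(snd a, fst a)"
    have a: "a \<in> R" "a \<notin> F" and F: "F \<subseteq> R" using insert by auto
    have aV: "a \<in> V \<times> V" "?b \<in> V \<times> V" using a R by (auto simp: mem_Times_iff)
    have aP: "a \<notin> ?P" and bP: "?b \<notin> ?P" using a R F by (auto simp: prod_eq_iff)
    have eq1: "R - F \<union> F\<inverse> = insert a ?P" using a by auto
    have eq2: "R - insert a F \<union> (insert a F)\<inverse> = insert ?b ?P" by (cases a) auto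
    have n: "net (insert a F) v = net {a} v + net F v" "net {?b} v = - net {a} v" for v
      using insert by (simp_all add: net_insert)
    have "flow_count V (insert ?b ?P) (\<lambda>v. e v - net (insert a F) v) =
        flow_count V ?P (\<lambda>v. e v - net F v - net {a} v) - flow_count V ?P (\<lambda>v. e v - net F v)"
      unfolding flow_count_insert[OF fin aV(2) bP] n by (simp add: algebra_simps)
    also have "\<dots> = - flow_count V (insert a ?P) (\<lambda>v. e v - net F v)"
      unfolding flow_count_insert[OF fin aV(1) aP] by simp
    also have "\<dots> = - ((- 1) ^ card F * flow_count V R e)"
      using insert.IH[OF F] unfolding eq1 by simp
    finally show ?case unfolding eq2 using insert by simp
  qed
qed


text \<open>Since \<open>R\<close> is balanced, replacing \<open>F\<close> by \<open>R - F\<close>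
  negates the net outflow, and the parities of the two sizes differ by that of
  \<open>card R\<close>.\<close>

lemma flow_count_compl:
  assumes fin: "finite V" and R: "R \<subseteq> V \<times> V" "\<And>v. v \<in> V \<Longrightarrow> net R v = 0"
  shows "flow_count V R (\<lambda>v. - e v) = (- 1) ^ card R * flow_count V R e"
proof -
  have finR: "finite R" using fin R by (meson finite_SigmaI finite_subset)
  have RV: "R \<inter> V \<times> V = R" using R by auto
  have "flow_count V R (\<lambda>v. - e v) =
      (\<Sum>F\<in>Pow R. (- 1) ^ card R * (of_bool (\<forall>v\<in>V. net F v = e v) * (- 1) ^ card F))"
    unfolding flow_count_def RV
  proof (rule sum.reindex_bij_witness[of _ "\<lambda>F. R - F" "\<lambda>F. R - F"])
    fix F assume "F \<in> Pow R"
    then have F: "F \<subseteq> R" "finite F" using finR finite_subset by auto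
    have "net R v = net F v + net (R - F) v" for v
      using net_Un[of F "R - F" v] F finR by (simp add: Un_absorb1)
    then have n: "net (R - F) v = - net F v" if "v \<in> V" for v
      using R(2)[OF that] by (metis add.inverse_unique)
    have c: "card R = card F + card (R - F)"
      using F finR by (simp add: card_Diff_subset card_mono)
    have "(- 1) ^ card R * (- 1) ^ card (R - F) = ((- 1) ^ card F :: int)"
      unfolding c power_add by (simp flip: power_mult_distrib)
    moreover have "(\<forall>v\<in>V. net (R - F) v = e v) \<longleftrightarrow> (\<forall>v\<in>V. net F v = - e v)"
      using n by (auto simp: equation_minus_iff)
    ultimately show "(- 1) ^ card R * (of_bool (\<forall>v\<in>V. net (R - F) v = e v) * (- 1) ^ card (R - F)) =
        (of_bool (\<forall>v\<in>V. net F v = - e v) * (- 1) ^ card F :: int)" by simp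
  qed auto
  then show ?thesis unfolding flow_count_def RV by (simp add: sum_distrib_left)
qed

section \<open>Injective images and ranked vertex sets\<close>

lemma net_image:
  assumes "inj f"
  shows "net (map_prod f f ` F) (f v) = net F v"
proof -
  have "inj_on (map_prod f f) F"
    by (rule inj_on_subset[OF prod.inj_map[OF assms assms]]) simp
  then show ?thesis
    unfolding net_def using assms by (simp add: sum.reindex inj_eq)
qed

lemma flow_count_image:
  assumes f: "inj f"
  shows "flow_count (f ` V) (map_prod f f ` R) e = flow_count V R (\<lambda>v. e (f v))"
proof -
  let ?m = "map_prod f f"
  have m: "inj ?m" using f by (rule prod.inj_map[OF _ f])
  have "?m ` R \<inter> f ` V \<times> f ` V = ?m ` (R \<inter> V \<times> V)"
    using f by (auto simp: inj_eq image_iff)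
  then have P: "Pow (?m ` R \<inter> f ` V \<times> f ` V) = image ?m ` Pow (R \<inter> V \<times> V)"
    by (simp add: image_Pow_surj del: Pow_Int_eq)
  have i: "inj_on (image ?m) (Pow (R \<inter> V \<times> V))"
    by (rule inj_on_image_Pow) (rule inj_on_subset[OF m], simp)
  have c: "card (?m ` F) = card F" for F
    by (rule card_image) (rule inj_on_subset[OF m], simp)
  show ?thesis unfolding flow_count_def P sum.reindex[OF i] by (simp add: net_image[OF f] c)
qed

text \<open>No arc goes down in rank, so the fibers can be glued on one at a time. A fiber with
  nonzero count has boundary sum 0, which is what \<open>flow_count_glue\<close> requires.\<close>

lemma flow_count_ranked:
  fixes r :: "'a \<Rightarrow> nat"
  assumes fin: "finite V"
    and R: "\<And>x y. (x, y) \<in> R \<Longrightarrow> x \<in> V \<Longrightarrow> y \<in> V \<Longrightarrow> r x \<le> r y"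
    and fiber: "\<And>i. i \<in> r ` V \<Longrightarrow> flow_count {v \<in> V. r v = i} R e \<noteq> 0"
  shows "flow_count V R e \<noteq> 0"
proof -
  have "flow_count {v \<in> V. r v < N} R e \<noteq> 0" for N
  proof (induction N)
    case 0
    then show ?case by simp
  next
    case (Suc N)
    let ?A = "{v \<in> V. r v < N}" and ?B = "{v \<in> V. r v = N}"
    have split: "{v \<in> V. r v < Suc N} = ?A \<union> ?B" by auto
    have B: "flow_count ?B R e \<noteq> 0"
    \<comment> \<open>Ranks that are not attained give empty fibers, whose flow count is 1.\<close>
    proof (cases "N \<in> r ` V")
      case False
      then have B: "?B = {}" by auto
      show ?thesis unfolding B by simp
    qed (use fiber in auto)
    have "flow_count (?A \<union> ?B) R e = flow_count ?A R e * flow_count ?B R e"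
      using fin R flow_count_nonzero_sum[OF _ B] by (intro flow_count_glue) fastforce+
    then show ?case using Suc B split by simp
  qed
  moreover have "{v \<in> V. r v < Suc (Max (r ` V))} = V" using fin by (auto simp: less_Suc_eq_le)
  ultimately show ?thesis by metis
qed

section \<open>Orientations with few incoming arcs\<close>

text \<open>An orientation of \<open>E\<close> on \<open>V\<close> as in the Alon-Tarsi number: with
  boundary 0 the flow count is the number of even minus the number of odd circulations. The bound
  may vary with the vertex and \<open>E\<close> may reach beyond \<open>V\<close>, so that parts of
  a graph can be treated separately.\<close>

definition AT_orientable :: "'a set \<Rightarrow> ('a \<times> 'a) set \<Rightarrow> ('a \<Rightarrow> nat) \<Rightarrow> bool" where
  "AT_orientable V E b \<longleftrightarrow> (\<exists>D. D \<union> D\<inverse> = E \<inter> V \<times> V \<and> D \<inter> D\<inverse> = {} \<and>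
     flow_count V D (\<lambda>_. 0) \<noteq> 0 \<and> (\<forall>v\<in>V. card {u. (u, v) \<in> D} \<le> b v))"

text \<open>\<open>R\<close> itself may violate the bounds. Reversing any flow \<open>F\<close> with
  boundary \<open>e\<close> corrects the indegrees by \<open>e\<close>, and
  \<open>flow_count_flip\<close> turns the given count into one with boundary 0.\<close>

lemma AT_orientableI:
  assumes fin: "finite V" and R: "R \<union> R\<inverse> = E \<inter> V \<times> V" "R \<inter> R\<inverse> = {}"
    and nz: "flow_count V R e \<noteq> 0"
    and b: "\<And>v. v \<in> V \<Longrightarrow> int (card {u. (u, v) \<in> R}) + e v \<le> int (b v)"
  shows "AT_orientable V E b"
proof -
  obtain F where F: "F \<subseteq> R \<inter> V \<times> V" "\<And>v. v \<in> V \<Longrightarrow> net F v = e v"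
    using flow_count_nonzeroE[OF nz] by metis
  have RV: "R \<subseteq> V \<times> V" and FR: "F \<subseteq> R" using R F by auto
  then have finR: "finite R" using fin by (meson finite_SigmaI finite_subset)
  then have finF: "finite F" using FR finite_subset by blast
  let ?D = "R - F \<union> F\<inverse>"
  have "flow_count V ?D (\<lambda>_. 0) = flow_count V ?D (\<lambda>v. e v - net F v)"
    using F by (intro flow_count_cong) auto
  also have "\<dots> = (- 1) ^ card F * flow_count V R e" by (rule flow_count_flip[OF fin RV R(2) FR])
  finally have nzD: "flow_count V ?D (\<lambda>_. 0) \<noteq> 0" using nz by simp
  have "card {u. (u, v) \<in> ?D} \<le> b v" if v: "v \<in> V" for v
  proof -
    \<comment> \<open>\<open>?I\<close> collects the in-neighbours that stay, \<open>?J\<close>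
      those gained by the reversal and \<open>?K\<close> those lost; \<open>?J\<close> and
      \<open>?K\<close> differ in size by \<open>net F v\<close>.\<close>
    let ?I = "{u. (u, v) \<in> R - F}" and ?J = "{u. (v, u) \<in> F}" and ?K = "{u. (u, v) \<in> F}"
    have "?I \<union> ?J \<union> ?K \<subseteq> V" using RV FR by auto
    then have finIJK: "finite ?I" "finite ?J" "finite ?K" using fin by (auto intro: finite_subset)
    have "?I \<inter> ?J = {}" using R(2) FR by blast
    moreover have "{u. (u, v) \<in> ?D} = ?I \<union> ?J" by auto
    ultimately have D: "card {u. (u, v) \<in> ?D} = card ?I + card ?J"
      using finIJK by (simp only: card_Un_disjoint)
    have "{u. (u, v) \<in> R} = ?I \<union> ?K" "?I \<inter> ?K = {}" using FR by auto
    then have "card {u. (u, v) \<in> R} = card ?I + card ?K"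
      using finIJK by (simp only: card_Un_disjoint)
    then have "int (card {u. (u, v) \<in> ?D}) = int (card {u. (u, v) \<in> R}) + net F v"
      using D net_eq_card[OF finF, of v] by simp
    then show ?thesis using b[OF v] F(2)[OF v] by simp
  qed
  moreover have "?D \<union> ?D\<inverse> = E \<inter> V \<times> V" unfolding R(1)[symmetric] using FR by auto
  moreover have "?D \<inter> ?D\<inverse> = {}" using R(2) FR by blast
  ultimately show ?thesis unfolding AT_orientable_def using nzD by blast
qed

lemma AT_orientable_mono:
  "AT_orientable V E b \<Longrightarrow> (\<And>v. v \<in> V \<Longrightarrow> b v \<le> b' v) \<Longrightarrow> AT_orientable V E b'"
  unfolding AT_orientable_def by (meson order_trans)

lemma AT_orientable_singleton: "(v, v) \<notin> E \<Longrightarrow> AT_orientable {v} E b"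
  unfolding AT_orientable_def by (intro exI[of _ "{}"]) (auto simp: flow_count_def)

text \<open>Each fiber keeps its own orientation and edges between fibers point upward in rank. The
  count stays nonzero by \<open>flow_count_ranked\<close>, and the only additional incoming arcs
  come from neighbours of lower rank.\<close>

lemma AT_orientable_ranked:
  fixes r :: "'a \<Rightarrow> nat"
  assumes fin: "finite V" and E: "sym E" "irrefl E"
    and fiber: "\<And>i. i \<in> r ` V \<Longrightarrow> AT_orientable {v \<in> V. r v = i} E b'"
    and b: "\<And>v. v \<in> V \<Longrightarrow> b' v + card {u \<in> V. (u, v) \<in> E \<and> r u < r v} \<le> b v"
  shows "AT_orientable V E b"
proof -
  let ?V = "\<lambda>i. {v \<in> V. r v = i}"
  have "\<forall>i\<in>r ` V. \<exists>D. D \<union> D\<inverse> = E \<inter> ?V i \<times> ?V i \<and> D \<inter> D\<inverse> = {} \<and>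
      flow_count (?V i) D (\<lambda>_. 0) \<noteq> 0 \<and> (\<forall>v\<in>?V i. card {u. (u, v) \<in> D} \<le> b' v)"
    using fiber unfolding AT_orientable_def by (intro ballI)
  from bchoice[OF this] obtain D where
    D: "\<And>i. i \<in> r ` V \<Longrightarrow> D i \<union> (D i)\<inverse> = E \<inter> ?V i \<times> ?V i \<and> D i \<inter> (D i)\<inverse> = {} \<and>
      flow_count (?V i) (D i) (\<lambda>_. 0) \<noteq> 0 \<and> (\<forall>v\<in>?V i. card {u. (u, v) \<in> D i} \<le> b' v)"
    by (elim exE) (rule that, drule (1) bspec)
  have DE: "(u, v) \<in> E \<longleftrightarrow> (u, v) \<in> D (r v) \<or> (v, u) \<in> D (r v)"
    if "u \<in> V" "v \<in> V" "r u = r v" for u v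
    using D[of "r v"] that by blast
  have DD: "(v, u) \<notin> D (r w)" if "(u, v) \<in> D (r w)" "w \<in> V" for u v w
    using D[of "r w"] that by blast
  define R where "R = {(u, v). u \<in> V \<and> v \<in> V \<and>
    (r u = r v \<and> (u, v) \<in> D (r v) \<or> r u < r v \<and> (u, v) \<in> E)}"
  have 1: "R \<union> R\<inverse> = E \<inter> V \<times> V"
  proof -
    have "(u, v) \<in> R \<union> R\<inverse> \<longleftrightarrow> (u, v) \<in> E \<inter> V \<times> V" for u v
      using DE[of u v] symD[OF E(1)] unfolding R_def by (cases "r u" "r v" rule: linorder_cases) auto
    then show ?thesis by auto
  qed
  have 2: "R \<inter> R\<inverse> = {}" using DD unfolding R_def by fastforce
  have 3: "flow_count V R (\<lambda>_. 0) \<noteq> 0"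
  proof (rule flow_count_ranked[OF fin])
    fix i assume i: "i \<in> r ` V"
    have "(x, y) \<in> R \<inter> ?V i \<times> ?V i \<longleftrightarrow> (x, y) \<in> D i \<inter> ?V i \<times> ?V i" for x y
      unfolding R_def by (cases "r y = i") auto
    then have "R \<inter> ?V i \<times> ?V i = D i \<inter> ?V i \<times> ?V i" by (simp only: set_eq_iff split_paired_All) blast
    then have "flow_count (?V i) R (\<lambda>_. 0) = flow_count (?V i) (D i) (\<lambda>_. 0)"
      by (intro flow_count_cong refl)
    then show "flow_count (?V i) R (\<lambda>_. 0) \<noteq> 0" using D[OF i] by simp
  qed (auto simp: R_def)
  have 4: "int (card {u. (u, v) \<in> R}) + 0 \<le> int (b v)" if v: "v \<in> V" for v
  proof -
    have "D (r v) \<subseteq> E \<inter> ?V (r v) \<times> ?V (r v)"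
      by (rule subset_trans[OF Un_upper1 equalityD1[OF D[THEN conjunct1, OF imageI[OF v]]]])
    then have "D (r v) \<subseteq> V \<times> V" by blast
    then have finD: "finite {u. (u, v) \<in> D (r v)}" by (intro finite_subset[OF _ fin]) auto
    have "card {u. (u, v) \<in> R} \<le> card ({u. (u, v) \<in> D (r v)} \<union> {u \<in> V. (u, v) \<in> E \<and> r u < r v})"
      using fin finD by (intro card_mono) (auto simp: R_def)
    also have "\<dots> \<le> card {u. (u, v) \<in> D (r v)} + card {u \<in> V. (u, v) \<in> E \<and> r u < r v}"
      by (rule card_Un_le)
    also have "\<dots> \<le> b' v + card {u \<in> V. (u, v) \<in> E \<and> r u < r v}" using D[of "r v"] v by simp
    finally show ?thesis using b[OF v] by simp
  qed
  show ?thesis by (rule AT_orientableI[OF fin 1 2 3 4])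
qed

text \<open>The fibers are single vertices: this is the acyclic orientation along a vertex ordering,
  whose only circulation is the edgeless one.\<close>

lemma AT_orientable_degenerate:
  fixes r :: "'a \<Rightarrow> nat"
  assumes fin: "finite V" and E: "sym E" "irrefl E" and r: "inj_on r V"
    and b: "\<And>v. v \<in> V \<Longrightarrow> card {u \<in> V. (u, v) \<in> E \<and> r u < r v} \<le> b v"
  shows "AT_orientable V E b"
proof (rule AT_orientable_ranked[OF fin E, where r = r and b' = "\<lambda>_. 0"])
  fix i assume "i \<in> r ` V"
  then obtain v where "v \<in> V" "i = r v" by auto
  then have "{u \<in> V. r u = i} = {v}" using r by (auto dest: inj_onD)
  then show "AT_orientable {u \<in> V. r u = i} E (\<lambda>_. 0)"
    using E(2) by (simp add: AT_orientable_singleton irrefl_def)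
qed (simp add: b)


section \<open>Flows through stacked odd cycles\<close>

text \<open>Stated for arbitrary relations, so that it serves for the product graph as well as for
  products of orientations. It is not confined to a vertex set; the intersection is taken where it
  is used.\<close>

definition product_arcs :: "('a \<times> 'a) set \<Rightarrow> ('b \<times> 'b) set \<Rightarrow> (('a \<times> 'b) \<times> ('a \<times> 'b)) set" where
  "product_arcs P Q = {((u, w), (u', w')). u = u' \<and> (w, w') \<in> Q \<or> w = w' \<and> (u, u') \<in> P}"

lemma product_arcs_iff [simp]:
  "((u, w), (u', w')) \<in> product_arcs P Q \<longleftrightarrow> u = u' \<and> (w, w') \<in> Q \<or> w = w' \<and> (u, u') \<in> P"
  by (simp add: product_arcs_def)

text \<open>As \<open>Q\<close> has no loop at \<open>w\<close>, the layer over \<open>w\<close>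
  carries exactly the copy of \<open>P\<close> under the injection \<open>?f\<close>.\<close>

lemma flow_count_layer:
  assumes "P \<subseteq> C \<times> C" "(w, w) \<notin> Q"
  shows "flow_count (C \<times> {w}) (product_arcs P Q) e = flow_count C P (\<lambda>v. e (v, w))"
proof -
  let ?f = "\<lambda>v. (v, w)"
  have "flow_count (C \<times> {w}) (product_arcs P Q) e = flow_count (?f ` C) (map_prod ?f ?f ` P) e"
  proof (subst flow_count_cong[where e' = e])
    show "product_arcs P Q \<inter> (C \<times> {w}) \<times> C \<times> {w} =
        map_prod ?f ?f ` P \<inter> (C \<times> {w}) \<times> C \<times> {w}"
      using assms by (auto simp: image_iff)
    have "C \<times> {w} = ?f ` C" by auto
    then show "flow_count (C \<times> {w}) (map_prod ?f ?f ` P) e = flow_count (?f ` C) (map_prod ?f ?f ` P) e"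
      by simp
  qed simp
  also have "\<dots> = flow_count C P (\<lambda>v. e (v, w))"
    by (rule flow_count_image) (simp add: inj_on_def)
  finally show ?thesis .
qed

text \<open>The matrix \<open>M\<close> of the outline. On the diagonal the boundary vanishes, so
  the entry counts circulations.\<close>

definition transfer :: "'a set \<Rightarrow> ('a \<times> 'a) set \<Rightarrow> 'a \<Rightarrow> 'a \<Rightarrow> int" where
  "transfer C P v s = flow_count C P (\<lambda>u. of_bool (u = v) - of_bool (u = s))"

text \<open>Complementation negates the boundary, which exchanges source and sink; the sign is that
  of an odd number of arcs.\<close>

lemma transfer_skew:
  assumes "finite C" "P \<subseteq> C \<times> C" "\<And>v. v \<in> C \<Longrightarrow> net P v = 0" "odd (card P)"
  shows "transfer C P v s = - transfer C P s v"
  using flow_count_compl[OF assms(1-3), of "\<lambda>u. of_bool (u = s) - of_bool (u = v)"] assms(4)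
  by (simp add: transfer_def)

text \<open>If \<open>y = x M\<close> and \<open>y M = 0\<close> for a skew-symmetric \<open>M\<close>, then \<open>y \<bullet> y = x M y\<^sup>T = 0\<close>.\<close>

lemma skew_image_nonzero:
  fixes M :: "'a \<Rightarrow> 'a \<Rightarrow> int"
  assumes fin: "finite C" and skew: "\<And>u v. M u v = - M v u"
    and y: "\<And>s. s \<in> C \<Longrightarrow> y s = (\<Sum>v\<in>C. x v * M v s)" and nz: "s \<in> C" "y s \<noteq> 0"
  shows "\<exists>s\<in>C. (\<Sum>v\<in>C. y v * M v s) \<noteq> 0"
proof (rule ccontr)
  assume "\<not> ?thesis"
  then have 0: "(\<Sum>v\<in>C. y v * M v s) = 0" if "s \<in> C" for s using that by blast
  have "(\<Sum>s\<in>C. y s * y s) = (\<Sum>s\<in>C. \<Sum>v\<in>C. y s * (x v * M v s))"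
    by (rule sum.cong[OF refl]) (subst (2) y, simp_all add: sum_distrib_left)
  also have "\<dots> = (\<Sum>v\<in>C. \<Sum>s\<in>C. y s * (x v * M v s))" by (rule sum.swap)
  also have "\<dots> = (\<Sum>v\<in>C. - x v * (\<Sum>s\<in>C. y s * M s v))"
    by (subst skew) (simp add: sum_distrib_left sum_negf algebra_simps)
  also have "\<dots> = 0" using 0 by simp
  finally have "\<forall>s\<in>C. y s * y s = 0" using fin by (subst (asm) sum_nonneg_eq_0_iff) auto
  then show False using nz by auto
qed

text \<open>\<open>a U w s\<close> counts unit flows from \<open>(t, hd ws)\<close> to
  \<open>(s, w)\<close> in the layers over \<open>U\<close>. Layers are added in the order of
  \<open>ws\<close>; each one multiplies the row vector of flows ending in the newest layer by
  \<open>- M\<close>, and \<open>skew_image_nonzero\<close> keeps this vector nonzero.\<close>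

lemma stacked_flow_nonzero:
  fixes C :: "'a set" and P :: "('a \<times> 'a) set" and Q :: "('b \<times> 'b) set" and t :: 'a and ws :: "'b list"
  defines "a \<equiv> \<lambda>U w s. flow_count (C \<times> U) (product_arcs P Q)
      (\<lambda>p. of_bool (p = (t, hd ws)) - of_bool (p = (s, w)))"
  assumes C: "finite C" "P \<subseteq> C \<times> C" "\<And>v. v \<in> C \<Longrightarrow> net P v = 0" "odd (card P)"
    and t: "t \<in> C" "s \<in> C" "transfer C P t s \<noteq> 0"
    and ws: "distinct ws" "ws \<noteq> []"
    and step: "\<And>i. Suc i < length ws \<Longrightarrow> (ws ! i, ws ! Suc i) \<in> Q"
    and up: "\<And>i j. i \<le> j \<Longrightarrow> j < length ws \<Longrightarrow> (ws ! j, ws ! i) \<notin> Q"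
  shows "\<exists>s\<in>C. a (set ws) (last ws) s \<noteq> 0"
proof -
  let ?M = "transfer C P"
  note skew = transfer_skew[OF C]
  \<comment> \<open>A diagonal entry of a skew-symmetric integer matrix vanishes: the circulations
    of a single layer cancel.\<close>
  have zero: "flow_count C P (\<lambda>_. 0) = 0"
    using skew[of t t] by (simp add: transfer_def)
  \<comment> \<open>Three invariants: the newest row vector lies in the image of \<open>M\<close>,
    as \<open>skew_image_nonzero\<close> demands; it is nonzero; and flows ending in an older layer
    cancel, so the next layer can only be reached from the newest one.\<close>
  have main: "(\<exists>x. \<forall>s\<in>C. a (set (take (Suc i) ws)) (ws ! i) s = (\<Sum>v\<in>C. x v * ?M v s)) \<and>
      (\<exists>s\<in>C. a (set (take (Suc i) ws)) (ws ! i) s \<noteq> 0) \<and>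
      (\<forall>j<i. \<forall>s\<in>C. a (set (take (Suc i) ws)) (ws ! j) s = 0)" if "i < length ws" for i
    using that
  proof (induction i)
    case 0
    let ?w = "hd ws"
    have w: "ws ! 0 = ?w" "take (Suc 0) ws = [?w]" using ws by (simp_all add: hd_conv_nth take_Suc)
    have "(?w, ?w) \<notin> Q" using up[of 0 0] 0 w by simp
    then have "a {?w} ?w s = ?M t s" for s
      unfolding a_def by (subst flow_count_layer[OF C(2)]) (simp_all add: transfer_def)
    \<comment> \<open>The first vector is row \<open>t\<close> of \<open>M\<close>, the image of the
      unit vector at \<open>t\<close>.\<close>
    then show ?case using t by (auto simp: w C(1) intro!: exI[of _ "\<lambda>v. of_bool (v = t)"])
  next
    case (Suc i)
    let ?U = "set (take (Suc i) ws)" and ?w = "ws ! i" and ?w' = "ws ! Suc i" and ?R = "product_arcs P Q"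
    have U': "set (take (Suc (Suc i)) ws) = ?U \<union> {?w'}"
      using Suc.prems by (simp add: take_Suc_conv_app_nth insert_commute)
    have mem: "u \<in> ?U \<longleftrightarrow> (\<exists>j\<le>i. u = ws ! j)" for u
      using nth_image[of "Suc i" ws] Suc.prems by (force simp: less_Suc_eq_le)
    have w'U: "?w' \<notin> ?U" using ws(1) Suc.prems by (auto simp: mem nth_eq_iff_index_eq)
    have hd: "hd ws \<in> ?U" using ws by (auto simp: mem hd_conv_nth)
    have w'w': "(?w', ?w') \<notin> Q" using up Suc.prems by blast
    have w'Q: "(?w', u) \<notin> Q" if "u \<in> ?U" for u using that up Suc.prems by (auto simp: mem)
    have split: "C \<times> (?U \<union> {?w'}) = C \<times> ?U \<union> C \<times> {?w'}" by auto
    have fin: "finite (C \<times> ?U)" "finite (C \<times> {?w'})" using C(1) by auto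
    have disj: "C \<times> ?U \<inter> C \<times> {?w'} = {}" using w'U by auto
    have BA: "?R \<inter> (C \<times> {?w'}) \<times> C \<times> ?U = {}" using w'Q w'U by auto
    obtain x where x: "\<And>s. s \<in> C \<Longrightarrow> a ?U ?w s = (\<Sum>v\<in>C. x v * ?M v s)"
      and nz: "\<exists>s\<in>C. a ?U ?w s \<noteq> 0" and below: "\<And>j s. j < i \<Longrightarrow> s \<in> C \<Longrightarrow> a ?U (ws ! j) s = 0"
      using Suc.IH[OF Suc_lessD[OF Suc.prems]] by blast
    \<comment> \<open>A flow ending in an older layer has boundary 0 on the new layer, which
      therefore splits off as the factor \<open>zero\<close>.\<close>
    have A: "a (?U \<union> {?w'}) u s = 0" if "u \<in> ?U" "s \<in> C" for u s
    proof -
      let ?e = "\<lambda>p. of_bool (p = (t, hd ws)) - of_bool (p = (s, u)) :: int"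
      have e0: "?e (v, ?w') = 0" for v using that w'U hd by auto
      have "sum ?e (C \<times> {?w'}) = 0" using e0 by (intro sum.neutral) auto
      from flow_count_glue[OF fin disj BA this] show ?thesis
        unfolding a_def split flow_count_layer[OF C(2) w'w'] e0 zero by simp
    qed
    \<comment> \<open>The new layer absorbs one unit, so exactly one arc enters it; the count is a
      sum over this arc.\<close>
    have B: "a (?U \<union> {?w'}) ?w' s = (\<Sum>v\<in>C. - a ?U ?w v * ?M v s)" if s: "s \<in> C" for s
    proof -
      let ?e = "\<lambda>p. of_bool (p = (t, hd ws)) - of_bool (p = (s, ?w')) :: int"
      have eB: "?e (v, ?w') = - of_bool (v = s)" for v using w'U hd by auto
      have "C \<times> {?w'} = (\<lambda>v. (v, ?w')) ` C" by auto
      then have "sum ?e (C \<times> {?w'}) = (\<Sum>v\<in>C. ?e (v, ?w'))" by (simp add: sum.reindex inj_on_def)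
      also have "\<dots> = - 1" unfolding eB using s C(1) by (simp add: sum_negf)
      finally have sum: "sum ?e (C \<times> {?w'}) = - 1" .
      define X where "X = (\<lambda>v. ((v, ?w), (v, ?w'))) ` C"
      let ?g = "\<lambda>b. flow_count (C \<times> ?U) ?R (\<lambda>p. ?e p - of_bool (fst b = p)) *
        flow_count (C \<times> {?w'}) ?R (\<lambda>p. ?e p + of_bool (snd b = p))"
      have g: "?g ((v, u), (v, ?w')) = a ?U u v * ?M v s" if "v \<in> C" "u \<in> ?U" for v u
      proof -
        have "flow_count (C \<times> ?U) ?R (\<lambda>p. ?e p - of_bool (fst ((v, u), (v, ?w')) = p)) = a ?U u v"
          unfolding a_def using w'U by (intro flow_count_cong) auto
        moreover have "flow_count (C \<times> {?w'}) ?R (\<lambda>p. ?e p + of_bool (snd ((v, u), (v, ?w')) = p)) = ?M v s"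
          unfolding flow_count_layer[OF C(2) w'w'] transfer_def eB by (intro flow_count_cong) auto
        ultimately show ?thesis by (simp only:)
      qed
      have "a (?U \<union> {?w'}) ?w' s = - sum ?g (?R \<inter> (C \<times> ?U) \<times> C \<times> {?w'})"
        unfolding a_def split by (rule flow_count_glue_one[OF fin disj BA sum])
      \<comment> \<open>Arcs that skip layers start where the count vanishes by
        \<open>below\<close>. What remains are the copies \<open>X\<close> of the path edge from
        \<open>?w\<close> to \<open>?w'\<close>.\<close>
      also have "sum ?g (?R \<inter> (C \<times> ?U) \<times> C \<times> {?w'}) = sum ?g X"
      proof (rule sum.mono_neutral_right)
        show "X \<subseteq> ?R \<inter> (C \<times> ?U) \<times> C \<times> {?w'}" using step Suc.prems by (auto simp: X_def mem)
        show "\<forall>b\<in>?R \<inter> (C \<times> ?U) \<times> C \<times> {?w'} - X. ?g b = 0"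
        proof
          fix b assume b: "b \<in> ?R \<inter> (C \<times> ?U) \<times> C \<times> {?w'} - X"
          then obtain v u where vu: "b = ((v, u), (v, ?w'))" "v \<in> C" "u \<in> ?U" using w'U by auto
          then have "u \<noteq> ?w" using b by (auto simp: X_def)
          then obtain j where "j < i" "u = ws ! j" using vu by (metis mem le_neq_implies_less)
          then have "a ?U u v = 0" using below vu by blast
          then show "?g b = 0" unfolding vu(1) g[OF vu(2,3)] by simp
        qed
      qed (use C(1) in auto)
      also have "\<dots> = (\<Sum>v\<in>C. ?g ((v, ?w), (v, ?w')))"
        unfolding X_def by (subst sum.reindex) (simp_all add: inj_on_def)
      also have "\<dots> = (\<Sum>v\<in>C. a ?U ?w v * ?M v s)"
        by (rule sum.cong[OF refl]) (rule g, auto simp: mem)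
      finally show ?thesis by (simp add: sum_negf)
    qed
    have "\<exists>s\<in>C. (\<Sum>v\<in>C. a ?U ?w v * ?M v s) \<noteq> 0"
      using nz skew_image_nonzero[OF C(1), of ?M "a ?U ?w" x] skew x by blast
    then have "\<exists>s\<in>C. a (?U \<union> {?w'}) ?w' s \<noteq> 0" using B by (simp add: sum_negf)
    moreover have "\<exists>x. \<forall>s\<in>C. a (?U \<union> {?w'}) ?w' s = (\<Sum>v\<in>C. x v * ?M v s)"
      using B by (intro exI[of _ "\<lambda>v. - a ?U ?w v"]) blast
    moreover have "\<forall>j<Suc i. \<forall>s\<in>C. a (?U \<union> {?w'}) (ws ! j) s = 0"
      using A mem by (auto simp: less_Suc_eq_le)
    ultimately show ?case unfolding U' by blast
  qed
  show ?thesis using main[of "length ws - 1"] ws by (simp add: last_conv_nth)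
qed


section \<open>Arcs of walks and directed cycles\<close>

lemma set_vwalk_arcs: "set (vwalk_arcs p) = {(p ! i, p ! Suc i) | i. Suc i < length p}"
proof (induction p rule: vwalk_arcs.induct)
  case (3 x y xs)
  have "{((x # y # xs) ! i, (x # y # xs) ! Suc i) | i. Suc i < length (x # y # xs)} =
      insert (x, y) {((y # xs) ! i, (y # xs) ! Suc i) | i. Suc i < length (y # xs)}"
    (is "?L = insert _ ?R")
  proof (intro equalityI subsetI)
    fix a assume "a \<in> ?L"
    then obtain i where "a = ((x # y # xs) ! i, (x # y # xs) ! Suc i)" "Suc i < length (x # y # xs)"
      by blast
    then show "a \<in> insert (x, y) ?R" by (cases i) auto
  next
    fix a assume "a \<in> insert (x, y) ?R"
    then consider "a = (x, y)" | i where "a = ((y # xs) ! i, (y # xs) ! Suc i)" "Suc i < length (y # xs)"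
      by blast
    then show "a \<in> ?L"
    proof cases
      case 1
      then have "a = ((x # y # xs) ! 0, (x # y # xs) ! Suc 0)" by simp
      then show ?thesis by fastforce
    next
      case (2 i)
      then have "a = ((x # y # xs) ! Suc i, (x # y # xs) ! Suc (Suc i))" "Suc (Suc i) < length (x # y # xs)"
        by simp_all
      then show ?thesis by blast
    qed
  qed
  with 3 show ?case by simp
qed auto

locale directed_cycle =
  fixes vs :: "'a list"
  assumes dist: "distinct vs" and L3: "3 \<le> length vs"
begin

definition L :: nat where "L = length vs"

definition nxt :: "nat \<Rightarrow> nat" where "nxt i = (if Suc i = L then 0 else Suc i)"

definition arc :: "nat \<Rightarrow> 'a \<times> 'a" where "arc i = (vs ! i, vs ! nxt i)"

definition P :: "('a \<times> 'a) set" where "P = set (vwalk_arcs (vs @ [hd vs]))"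

lemma P_eq: "P = arc ` {..<L}"
proof -
  have "(vs @ [hd vs]) ! i = vs ! i" "(vs @ [hd vs]) ! Suc i = vs ! nxt i" if "i < L" for i
    using that L3 by (auto simp: L_def nth_append nxt_def intro!: hd_conv_nth)
  moreover have "P = (\<lambda>i. ((vs @ [hd vs]) ! i, (vs @ [hd vs]) ! Suc i)) ` {..<L}"
    unfolding P_def set_vwalk_arcs L_def by auto
  ultimately show ?thesis by (simp add: arc_def)
qed

lemma nth_eq: "i < L \<Longrightarrow> j < L \<Longrightarrow> vs ! i = vs ! j \<longleftrightarrow> i = j"
  using dist by (simp add: L_def nth_eq_iff_index_eq)

lemma nxt_less: "i < L \<Longrightarrow> nxt i < L"
  by (auto simp: nxt_def)

text \<open>Writing a vertex as a successor makes \<open>arc i\<close> its incoming arc.\<close>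

lemma vertexE:
  assumes "v \<in> set vs"
  obtains i where "i < L" "v = vs ! nxt i"
proof -
  obtain j where j: "j < L" "v = vs ! j" using assms by (auto simp: in_set_conv_nth L_def)
  have "\<exists>i<L. nxt i = j"
    using j L3 by (intro exI[of _ "if j = 0 then L - 1 else j - 1"]) (auto simp: L_def nxt_def)
  then show ?thesis using that j by blast
qed

lemma P_subset: "P \<subseteq> set vs \<times> set vs"
  using nxt_less by (auto simp: P_eq arc_def simp flip: L_def intro!: nth_mem)

lemma card_P: "card P = L"
  unfolding P_eq by (subst card_image) (auto simp: inj_on_def arc_def nth_eq)

text \<open>Opposite arcs would make two positions successors of each other, which length at least 3
  excludes.\<close>

lemma P_antisym: "P \<inter> P\<inverse> = {}"
proof -
  have False if "i < L" "j < L" "arc i = (v, u)" "arc j = (u, v)" for i j u v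
  proof -
    have "vs ! i = vs ! nxt j" "vs ! j = vs ! nxt i" using that by (simp_all add: arc_def)
    then have "i = nxt j" "j = nxt i" using that by (simp_all add: nth_eq nxt_less)
    then show False using that L3 by (auto simp: nxt_def L_def split: if_splits)
  qed
  then have "(u, v) \<notin> P \<or> (v, u) \<notin> P" for u v
    unfolding P_eq by (metis imageE lessThan_iff)
  then show ?thesis by auto
qed

lemma out_arcs_eq:
  assumes "F \<subseteq> P" "i < L"
  shows "{u. (vs ! i, u) \<in> F} = (if arc i \<in> F then {vs ! nxt i} else {})"
proof -
  have "u = vs ! nxt i" if "(vs ! i, u) \<in> P" for u
    using that assms(2) by (auto simp: P_eq arc_def nth_eq)
  then show ?thesis using assms(1) by (auto simp: arc_def)
qed

lemma in_arcs_eq: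
  assumes "F \<subseteq> P" "i < L"
  shows "{u. (u, vs ! nxt i) \<in> F} = (if arc i \<in> F then {vs ! i} else {})"
proof -
  have "u = vs ! i" if u: "(u, vs ! nxt i) \<in> P" for u
  proof -
    obtain j where "j < L" "arc j = (u, vs ! nxt i)"
      using u unfolding P_eq by (metis imageE lessThan_iff)
    then have j: "j < L" "u = vs ! j" "vs ! nxt i = vs ! nxt j" by (simp_all add: arc_def)
    then have "nxt i = nxt j" using assms(2) by (simp add: nth_eq nxt_less)
    then have "i = j" by (simp add: nxt_def split: if_splits)
    then show ?thesis by (simp add: j)
  qed
  then show ?thesis using assms(1) by (auto simp: arc_def)
qed

lemma in_degree_P: "v \<in> set vs \<Longrightarrow> card {u. (u, v) \<in> P} = 1"
  by (erule vertexE) (simp add: in_arcs_eq[OF order_refl], simp add: P_eq)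

lemma out_degree_P: "v \<in> set vs \<Longrightarrow> card {u. (v, u) \<in> P} = 1"
  by (auto simp: in_set_conv_nth out_arcs_eq[OF order_refl] simp flip: L_def) (simp_all add: P_eq)

lemma finite_P: "finite P"
  by (simp add: P_def)

lemma net_P: "v \<in> set vs \<Longrightarrow> net P v = 0"
  using net_eq_card[OF finite_P] in_degree_P out_degree_P by simp

text \<open>The flow is unique: the source forces \<open>arc 0\<close> in, the sink forces
  \<open>arc 1\<close> out, and conservation carries this absence around the cycle. The single arc
  has sign -1. This is the nonzero entry of \<open>M\<close> from which the stacking starts.\<close>

lemma transfer_arc: "transfer (set vs) P (vs ! 0) (vs ! 1) = - 1"
proof -
  have L: "3 \<le> L" using L3 by (simp add: L_def)
  let ?e = "\<lambda>u. of_bool (u = vs ! 0) - of_bool (u = vs ! 1) :: int"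
  have arc0: "arc 0 = (vs ! 0, vs ! 1)" using L by (simp add: arc_def nxt_def)
  have only: "F = {arc 0}" if F: "F \<subseteq> P" "\<And>v. v \<in> set vs \<Longrightarrow> net F v = ?e v" for F
  proof -
    have fF: "finite F" using F finite_P finite_subset by blast
    have x: "of_bool (arc (nxt i) \<in> F) - of_bool (arc i \<in> F) = ?e (vs ! nxt i)"
      if "i < L" for i
    proof -
      have "net F (vs ! nxt i) =
          of_bool (arc (nxt i) \<in> F) - of_bool (arc i \<in> F)"
        unfolding net_eq_card[OF fF] out_arcs_eq[OF F(1) nxt_less[OF that]] in_arcs_eq[OF F(1) that] by simp
      then show ?thesis using F(2) nxt_less[OF that] by (simp add: L_def)
    qed
    \<comment> \<open>Since \<open>nxt (L - 1) = 0\<close>, the instance at \<open>L - 1\<close> is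
      the equation at the source \<open>vs ! 0\<close>.\<close>
    have "arc 0 \<in> F" using x[of "L - 1"] L nth_eq[of 0 1] by (auto simp: nxt_def of_bool_def split: if_splits)
    moreover have "arc 1 \<notin> F" using x[of 0] L nth_eq[of 1 0] by (auto simp: nxt_def of_bool_def split: if_splits)
    then have "arc (Suc i) \<notin> F" if "Suc i < L" for i
      using that
    proof (induction i)
      case (Suc i)
      then show ?case using x[of "Suc i"] nth_eq[of "Suc (Suc i)" 0] nth_eq[of "Suc (Suc i)" 1]
        by (auto simp: nxt_def of_bool_def split: if_splits)
    qed simp
    then have "i = 0" if "i < L" "arc i \<in> F" for i using that by (cases i) auto
    ultimately show ?thesis using F(1) unfolding P_eq by blast
  qed
  have "arc 0 \<in> P" using L by (auto simp: P_eq)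
  have "flow_count (set vs) P ?e =
      (\<Sum>F\<in>Pow P. of_bool (\<forall>v\<in>set vs. net F v = ?e v) * (- 1) ^ card F)"
    unfolding flow_count_def using P_subset by (simp add: Int_absorb2 del: Pow_Int_eq)
  also have "\<dots> = (\<Sum>F\<in>{{arc 0}}. of_bool (\<forall>v\<in>set vs. net F v = ?e v) * (- 1) ^ card F)"
  proof (rule sum.mono_neutral_right)
    show "\<forall>F\<in>Pow P - {{arc 0}}. of_bool (\<forall>v\<in>set vs. net F v = ?e v) * (- 1) ^ card F = (0 :: int)"
    proof
      fix F assume "F \<in> Pow P - {{arc 0}}"
      then have "\<not> (\<forall>v\<in>set vs. net F v = ?e v)" using only by blast
      then show "of_bool (\<forall>v\<in>set vs. net F v = ?e v) * (- 1) ^ card F = (0 :: int)"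
        by (simp only: of_bool_eq mult_zero_left)
    qed
  qed (use finite_P \<open>arc 0 \<in> P\<close> in auto)
  also have "\<dots> = - 1" by (simp add: arc0 eq_commute)
  finally show ?thesis by (simp add: transfer_def)
qed

end


section \<open>Products of odd cycles and complete graphs with a traceable graph\<close>

locale hamiltonian_order =
  fixes E :: "('b \<times> 'b) set" and ws :: "'b list" and k :: nat
  assumes sym_E: "sym E" and irrefl_E: "irrefl E"
    and dist_ws: "distinct ws" and len_ws: "2 \<le> length ws"
    and path: "\<And>i. Suc i < length ws \<Longrightarrow> (ws ! i, ws ! Suc i) \<in> E"
    and back_degree: "\<And>i. i < length ws \<Longrightarrow> card {w \<in> set (take i ws). (w, ws ! i) \<in> E} \<le> k"
begin

text \<open>The acyclic orientation along the listing; by \<open>back_degree\<close> its indegrees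
  are at most \<open>k\<close>.\<close>

definition up :: "('b \<times> 'b) set" where
  "up = {(w, w'). \<exists>i<length ws. w' = ws ! i \<and> w \<in> set (take i ws) \<and> (w, w') \<in> E}"

lemma nth_up_iff: "i < length ws \<Longrightarrow> (w, ws ! i) \<in> up \<longleftrightarrow> w \<in> set (take i ws) \<and> (w, ws ! i) \<in> E"
  using dist_ws by (auto simp: up_def nth_eq_iff_index_eq)

lemma nth_in_take_iff: "i < length ws \<Longrightarrow> j < length ws \<Longrightarrow> ws ! j \<in> set (take i ws) \<longleftrightarrow> j < i"
  using dist_ws by (auto simp: in_set_conv_nth nth_eq_iff_index_eq)

lemma nth_nth_up_iff:
  "i < length ws \<Longrightarrow> j < length ws \<Longrightarrow> (ws ! j, ws ! i) \<in> up \<longleftrightarrow> j < i \<and> (ws ! j, ws ! i) \<in> E"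
  by (simp add: nth_up_iff nth_in_take_iff)

lemma up_Un: "up \<union> up\<inverse> = E \<inter> set ws \<times> set ws"
proof -
  have "(w, w') \<in> up \<union> up\<inverse> \<longleftrightarrow> (w, w') \<in> E" if ww': "w \<in> set ws" "w' \<in> set ws" for w w'
  proof -
    obtain i j where ij: "i < length ws" "j < length ws" "w = ws ! i" "w' = ws ! j"
      using ww' by (metis in_set_conv_nth)
    show ?thesis
      using sym_E irrefl_E by (cases i j rule: linorder_cases)
        (auto simp: ij nth_nth_up_iff irrefl_def dest: symD)
  qed
  moreover have "up \<union> up\<inverse> \<subseteq> set ws \<times> set ws" by (auto simp: up_def dest: in_set_takeD)
  ultimately show ?thesis by auto
qed

lemma up_antisym: "(w, w') \<in> up \<Longrightarrow> (w', w) \<notin> up"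
proof
  assume 1: "(w, w') \<in> up" and 2: "(w', w) \<in> up"
  then have "w \<in> set ws" "w' \<in> set ws" using up_Un by blast+
  then obtain i j where "i < length ws" "j < length ws" "w = ws ! i" "w' = ws ! j"
    by (metis in_set_conv_nth)
  with 1 2 show False by (simp add: nth_nth_up_iff)
qed

text \<open>The second vertex of the path has the first one as an earlier neighbour. This leaves
  room for the source of the flow, whose indegree is raised by one.\<close>

lemma k_pos: "1 \<le> k"
proof -
  have "{w \<in> set (take 1 ws). (w, ws ! 1) \<in> E} \<noteq> {}"
    using path[of 0] len_ws nth_in_take_iff[of 1 0] by force
  then have "0 < card {w \<in> set (take 1 ws). (w, ws ! 1) \<in> E}" by (simp add: card_gt_0_iff)
  moreover have "card {w \<in> set (take 1 ws). (w, ws ! 1) \<in> E} \<le> k"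
    by (rule back_degree) (use len_ws in simp)
  ultimately show ?thesis by linarith
qed

text \<open>In \<open>R\<close> a vertex receives one arc from its layer and at most
  \<open>k\<close> from earlier layers. The nonzero boundary \<open>?e\<close> from
  \<open>stacked_flow_nonzero\<close> is positive at most in the first layer.\<close>

lemma AT_orientable_odd_cycle_product:
  assumes vs: "distinct vs" "3 \<le> length vs" "odd (length vs)"
    and EG: "EG \<inter> set vs \<times> set vs =
      set (vwalk_arcs (vs @ [hd vs])) \<union> (set (vwalk_arcs (vs @ [hd vs])))\<inverse>"
  shows "AT_orientable (set vs \<times> set ws) (product_arcs EG E) (\<lambda>_. k + 1)"
proof -
  interpret directed_cycle vs using vs by unfold_locales
  note EG = EG[folded P_def]
  let ?V = "set vs \<times> set ws"
  define R where "R = product_arcs P up \<inter> ?V \<times> ?V"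
  have "\<exists>s\<in>set vs. flow_count ?V (product_arcs P up)
      (\<lambda>p. of_bool (p = (vs ! 0, hd ws)) - of_bool (p = (s, last ws))) \<noteq> 0"
  proof (rule stacked_flow_nonzero[where s = "vs ! 1"])
    show "odd (card P)" using card_P vs by (simp add: L_def)
    show "transfer (set vs) P (vs ! 0) (vs ! 1) \<noteq> 0" using transfer_arc by simp
    show "vs ! 0 \<in> set vs" "vs ! 1 \<in> set vs" using vs(2) by (auto intro!: nth_mem)
    show "ws \<noteq> []" using len_ws by auto
    show "(ws ! i, ws ! Suc i) \<in> up" if "Suc i < length ws" for i
      using that path by (simp add: nth_nth_up_iff)
    show "(ws ! j, ws ! i) \<notin> up" if "i \<le> j" "j < length ws" for i j
      using that by (simp add: nth_nth_up_iff)
  qed (use P_subset net_P dist_ws in auto)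
  then obtain s where nz: "flow_count ?V (product_arcs P up)
      (\<lambda>p. of_bool (p = (vs ! 0, hd ws)) - of_bool (p = (s, last ws))) \<noteq> 0" (is "flow_count _ _ ?e \<noteq> 0")
    by blast
  have "flow_count ?V R ?e = flow_count ?V (product_arcs P up) ?e"
    by (rule flow_count_cong) (auto simp: R_def)
  with nz have nzR: "flow_count ?V R ?e \<noteq> 0" by simp
  have 1: "R \<union> R\<inverse> = product_arcs EG E \<inter> ?V \<times> ?V"
  proof -
    have *: "((u, w), (u', w')) \<in> R \<union> R\<inverse> \<longleftrightarrow> ((u, w), (u', w')) \<in> product_arcs EG E"
      if "u \<in> set vs" "u' \<in> set vs" "w \<in> set ws" "w' \<in> set ws" for u u' w w'
    proof -
      have "(u, u') \<in> EG \<longleftrightarrow> (u, u') \<in> P \<or> (u', u) \<in> P" using EG that by blast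
      moreover have "(w, w') \<in> E \<longleftrightarrow> (w, w') \<in> up \<or> (w', w) \<in> up" using up_Un that by blast
      ultimately show ?thesis using that by (auto simp: R_def)
    qed
    have "(p, q) \<in> R \<union> R\<inverse> \<longleftrightarrow> (p, q) \<in> product_arcs EG E" if "p \<in> ?V" "q \<in> ?V" for p q
      using *[of "fst p" "fst q" "snd p" "snd q"] that by (simp only: mem_Times_iff prod.collapse)
    moreover have "R \<union> R\<inverse> \<subseteq> ?V \<times> ?V" by (auto simp: R_def)
    ultimately show ?thesis by blast
  qed
  have 2: "R \<inter> R\<inverse> = {}"
  proof -
    have "(u', u) \<notin> P" if "(u, u') \<in> P" for u u' using P_antisym that by blast
    then show ?thesis using up_antisym by (fastforce simp: R_def)
  qed
  have 3: "int (card {p. (p, q) \<in> R}) + ?e q \<le> int (k + 1)" if q: "q \<in> ?V" for q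
  proof -
    obtain v i where vi: "q = (v, ws ! i)" "v \<in> set vs" "i < length ws"
      using q by (auto simp: in_set_conv_nth)
    let ?B = "{w \<in> set (take i ws). (w, ws ! i) \<in> E}"
    have fin: "finite {u. (u, v) \<in> P}" using P_subset by (auto intro: finite_subset[of _ "set vs"])
    have "card {p. (p, q) \<in> R} \<le> card ((\<lambda>u. (u, ws ! i)) ` {u. (u, v) \<in> P} \<union> Pair v ` ?B)"
      by (rule card_mono) (use fin in \<open>auto simp: R_def vi nth_up_iff\<close>)
    also have "\<dots> \<le> card {u. (u, v) \<in> P} + card ?B"
      by (rule order_trans[OF card_Un_le add_mono[OF card_image_le card_image_le]]) (use fin in auto)
    finally have c: "card {p. (p, q) \<in> R} \<le> 1 + card ?B" using in_degree_P[OF vi(2)] by simp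
    show ?thesis
    \<comment> \<open>The first layer receives nothing from below, so adding the unit at the source
      gives at most 2, within \<open>k + 1\<close> by \<open>k_pos\<close>. In all other layers the
      boundary is at most 0.\<close>
    proof (cases "i = 0")
      case True
      have "?e q \<le> 1" by (simp add: of_bool_def)
      moreover have "card ?B = 0" using True by simp
      ultimately show ?thesis using c k_pos by linarith
    next
      case False
      have "0 < length ws" using len_ws by linarith
      then have "ws ! i \<noteq> ws ! 0" using nth_eq_iff_index_eq[OF dist_ws vi(3)] False by blast
      then have "ws ! i \<noteq> hd ws" using \<open>0 < length ws\<close> by (simp add: hd_conv_nth)
      then have "?e q \<le> 0" by (simp add: vi)
      then show ?thesis using c back_degree[OF vi(3)] by linarith
    qed
  qed
  show ?thesis by (rule AT_orientableI[OF _ 1 2 nzR 3]) simp_all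
qed

lemma sym_irrefl_product:
  assumes "sym EG" "irrefl EG"
  shows "sym (product_arcs EG E)" "irrefl (product_arcs EG E)"
proof -
  show "sym (product_arcs EG E)"
    using symD[OF assms(1)] symD[OF sym_E] by (intro symI) (auto simp: product_arcs_def)
  show "irrefl (product_arcs EG E)"
    using assms(2) irrefl_E by (auto simp: irrefl_def)
qed

text \<open>The fiber over \<open>u\<close> is a copy of \<open>E\<close> on \<open>ws\<close>;
  ordering it by position in \<open>ws\<close> turns \<open>back_degree\<close> into the
  bound.\<close>

lemma AT_orientable_fiber:
  fixes EG :: "('a \<times> 'a) set" and u :: 'a
  assumes EG: "sym EG" "irrefl EG"
  shows "AT_orientable ({u} \<times> set ws) (product_arcs EG E) (\<lambda>_. k)"
proof -
  define r where "r p = the_inv_into {..<length ws} ((!) ws) (snd p)" for p :: "'a \<times> 'b"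
  have "inj_on ((!) ws) {..<length ws}" using dist_ws by (simp add: inj_on_nth)
  then have r: "r (v, ws ! i) = i" if "i < length ws" for v i
    using that by (simp add: r_def the_inv_into_f_f)
  show ?thesis
  proof (rule AT_orientable_degenerate[OF _ sym_irrefl_product[OF EG], of _ r])
    show "inj_on r ({u} \<times> set ws)" using r by (auto simp: inj_on_def in_set_conv_nth)
    fix q assume "q \<in> {u} \<times> set ws"
    then obtain i where i: "i < length ws" "q = (u, ws ! i)" by (auto simp: in_set_conv_nth)
    have "{p \<in> {u} \<times> set ws. (p, q) \<in> product_arcs EG E \<and> r p < r q} \<subseteq>
        Pair u ` {w \<in> set (take i ws). (w, ws ! i) \<in> E}" (is "?X \<subseteq> Pair u ` ?B")
    proof
      fix p assume p: "p \<in> ?X"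
      then obtain j where j: "j < length ws" "p = (u, ws ! j)" by (auto simp: in_set_conv_nth)
      then have "j < i" using p i r by simp
      then show "p \<in> Pair u ` ?B" using p i j EG(2) by (auto simp: nth_in_take_iff irrefl_def)
    qed
    then have "card ?X \<le> card (Pair u ` ?B)" by (rule card_mono[rotated]) simp
    also have "\<dots> \<le> card ?B" by (rule card_image_le) simp
    also have "\<dots> \<le> k" by (rule back_degree[OF i(1)])
    finally show "card ?X \<le> k" .
  qed simp
qed

text \<open>All but three vertices of \<open>T\<close> are ranked one by one, and the last three
  form a triangle, an odd cycle. A vertex has at most \<open>card T - 3\<close> neighbours of lower
  rank, on top of the bound \<open>k + 1\<close> within its fiber.\<close>

lemma AT_orientable_complete_product:
  assumes EG: "sym EG" "irrefl EG" and T: "finite T" "3 \<le> card T"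
    and complete: "\<And>u v. u \<in> T \<Longrightarrow> v \<in> T \<Longrightarrow> u \<noteq> v \<Longrightarrow> (u, v) \<in> EG"
  shows "AT_orientable (T \<times> set ws) (product_arcs EG E) (\<lambda>_. card T + k - 2)"
proof -
  obtain us where us: "set us = T" "distinct us" using finite_distinct_list[OF T(1)] by blast
  then have len: "length us = card T" using distinct_card by metis
  define c where "c = card T - 3"
  \<comment> \<open>The position in \<open>us\<close> capped at \<open>c\<close>: ranks below
    \<open>c\<close> belong to single vertices, rank \<open>c\<close> to the last three.\<close>
  define f where "f u = min (the_inv_into {..<length us} ((!) us) u) c" for u
  have "inj_on ((!) us) {..<length us}" using us by (simp add: inj_on_nth)
  then have f: "f (us ! i) = min i c" if "i < length us" for i
    using that by (simp add: f_def the_inv_into_f_f)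
  have nth: "us ! i = us ! j \<longleftrightarrow> i = j" if "i < length us" "j < length us" for i j
    using that us by (simp add: nth_eq_iff_index_eq)
  show ?thesis
  proof (rule AT_orientable_ranked[OF _ sym_irrefl_product[OF EG], of _ "\<lambda>p. f (fst p)" "\<lambda>_. k + 1"])
    fix i assume i: "i \<in> (\<lambda>p. f (fst p)) ` (T \<times> set ws)"
    have fiber: "{p \<in> T \<times> set ws. f (fst p) = i} = {u \<in> T. f u = i} \<times> set ws" by auto
    have "i \<le> c" using i by (auto simp: f_def)
    show "AT_orientable {p \<in> T \<times> set ws. f (fst p) = i} (product_arcs EG E) (\<lambda>_. k + 1)"
    proof (cases "i < c")
      case True
      then have "i < length us" by (simp add: c_def len)
      then have "{u \<in> T. f u = i} = {us ! i}"
        using True f by (auto simp: us(1)[symmetric] in_set_conv_nth min_def split: if_splits)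
      moreover have "AT_orientable ({us ! i} \<times> set ws) (product_arcs EG E) (\<lambda>_. k + 1)"
        by (rule AT_orientable_mono[OF AT_orientable_fiber[OF EG]]) simp
      ultimately show ?thesis by (simp only: fiber)
    next
      case False
      define x y z where "x = us ! c" and "y = us ! Suc c" and "z = us ! Suc (Suc c)"
      have c: "c + 3 = length us" using T(2) by (simp add: c_def len)
      have xyz: "{x, y, z} \<subseteq> T" "x \<noteq> y" "y \<noteq> z" "x \<noteq> z"
        using c by (auto simp: us(1)[symmetric] x_def y_def z_def nth)
      have "{u \<in> T. f u = i} = {x, y, z}"
      proof -
        have fi: "f (us ! j) = i \<longleftrightarrow> j = c \<or> j = Suc c \<or> j = Suc (Suc c)" if "j < length us" for j
          using that f[OF that] c False \<open>i \<le> c\<close> by auto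
        have "{u \<in> T. f u = i} \<subseteq> {x, y, z}"
          using fi by (auto simp: us(1)[symmetric] in_set_conv_nth x_def y_def z_def)
        moreover have "{x, y, z} \<subseteq> {u \<in> T. f u = i}"
          using xyz(1) fi[of c] fi[of "Suc c"] fi[of "Suc (Suc c)"] c
          by (simp add: x_def y_def z_def)
        ultimately show ?thesis by blast
      qed
      then have "{p \<in> T \<times> set ws. f (fst p) = i} = set [x, y, z] \<times> set ws" by (simp add: fiber)
      moreover have "AT_orientable (set [x, y, z] \<times> set ws) (product_arcs EG E) (\<lambda>_. k + 1)"
      proof (rule AT_orientable_odd_cycle_product)
        show "EG \<inter> set [x, y, z] \<times> set [x, y, z] = set (vwalk_arcs ([x, y, z] @ [hd [x, y, z]])) \<union>
            (set (vwalk_arcs ([x, y, z] @ [hd [x, y, z]])))\<inverse>"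
          using xyz EG complete by (auto simp: irrefl_def)
      qed (use xyz in auto)
      ultimately show ?thesis by simp
    qed
  next
    fix q assume q: "q \<in> T \<times> set ws"
    have "{p \<in> T \<times> set ws. (p, q) \<in> product_arcs EG E \<and> f (fst p) < f (fst q)} \<subseteq>
        (\<lambda>i. (us ! i, snd q)) ` {..<c}" (is "?X \<subseteq> ?Y")
    proof
      fix p assume p: "p \<in> ?X"
      then have "fst p \<noteq> fst q" by auto
      with p have "snd p = snd q" by (cases p; cases q) auto
      moreover obtain j where j: "j < length us" "fst p = us ! j"
        using p us(1) by (auto simp: in_set_conv_nth)
      moreover have "f (fst p) < c" using p by (simp add: f_def)
      then have "j < c" using f[OF j(1)] j(2) by simp
      ultimately show "p \<in> ?Y" by (auto simp: image_iff prod_eq_iff)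
    qed
    then have "card ?X \<le> card ?Y" by (rule card_mono[rotated]) simp
    also have "\<dots> \<le> card {..<c}" by (rule card_image_le) simp
    finally have "card ?X \<le> c" by simp
    then show "k + 1 + card ?X \<le> card T + k - 2" using T(2) by (simp add: c_def)
  qed (use T in auto)
qed

end


section \<open>The Alon-Tarsi number\<close>

lemma in_degree_with_proj: "in_degree (with_proj G) v = card {u. (u, v) \<in> parcs G}"
proof -
  have "in_arcs (with_proj G) v = (\<lambda>u. (u, v)) ` {u. (u, v) \<in> parcs G}"
    by (auto simp: in_arcs_def)
  then show ?thesis by (simp add: in_degree_def card_image inj_on_def)
qed

lemma out_degree_with_proj: "out_degree (with_proj G) v = card {u. (v, u) \<in> parcs G}"
proof -
  have "out_arcs (with_proj G) v = Pair v ` {u. (v, u) \<in> parcs G}"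
    by (auto simp: out_arcs_def)
  then show ?thesis by (simp add: out_degree_def card_image inj_on_def)
qed

text \<open>A circulation is determined by its arc set, and indegree equals outdegree exactly where
  \<open>net\<close> vanishes; the signs separate even from odd.\<close>

lemma flow_count_circulations:
  fixes D :: "('a \<times> 'a) set"
  assumes fin: "finite V" and D: "D \<subseteq> V \<times> V"
  defines "G \<equiv> \<lparr>pverts = V, parcs = D\<rparr>"
  shows "flow_count V D (\<lambda>_. 0) =
    int (card (even_circulations G)) - int (card (odd_circulations G))"
proof -
  let ?g = "\<lambda>F. \<lparr>pverts = V, parcs = F\<rparr>" and ?C = "{F \<in> Pow D. \<forall>v\<in>V. net F v = 0}"
  have finD: "finite D" using fin D by (meson finite_SigmaI finite_subset)
  have wf: "wf_digraph (with_proj (?g F))" if "F \<subseteq> D" for F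
    using that D unfolding wf_digraph_def by auto
  have bal: "in_degree (with_proj E) v = out_degree (with_proj E) v \<longleftrightarrow> net (parcs E) v = 0"
    if "parcs E \<subseteq> D" for E :: "'a pair_pre_digraph" and v
    using net_eq_card[of "parcs E" v] that finD
    by (auto simp: in_degree_with_proj out_degree_with_proj finite_subset)
  have "circulation E G \<longleftrightarrow> E \<in> ?g ` ?C" for E
  proof
    assume E: "circulation E G"
    then have "pverts E = V" "parcs E \<subseteq> D"
      by (auto simp: circulation_def spanning_def subgraph_def G_def)
    moreover from this have "net (parcs E) v = 0" if "v \<in> V" for v
      using E that bal[of E v] by (simp add: circulation_def G_def)
    moreover from \<open>pverts E = V\<close> have "E = ?g (parcs E)" by simp
    ultimately show "E \<in> ?g ` ?C" by blast
  next
    assume "E \<in> ?g ` ?C"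
    then obtain F where F: "E = ?g F" "F \<subseteq> D" "\<forall>v\<in>V. net F v = 0" by auto
    then show "circulation E G"
      using wf[of F] wf[of D] bal[of E]
      by (simp add: circulation_def spanning_def subgraph_def compatible_def G_def)
  qed
  then have "even_circulations G = ?g ` {F \<in> ?C. even (card F)}"
    and "odd_circulations G = ?g ` {F \<in> ?C. odd (card F)}"
    unfolding even_circulations_def odd_circulations_def by auto
  then have card: "card (even_circulations G) = card {F \<in> ?C. even (card F)}"
    "card (odd_circulations G) = card {F \<in> ?C. odd (card F)}"
    by (simp_all add: card_image inj_on_def)
  have finC: "finite ?C" using finD by simp
  have "flow_count V D (\<lambda>_. 0) = (\<Sum>F\<in>Pow D. if \<forall>v\<in>V. net F v = 0 then (- 1) ^ card F else 0)"
    unfolding flow_count_def Int_absorb2[OF D] by (intro sum.cong refl) simp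
  also have "\<dots> = (\<Sum>F\<in>?C. (- 1) ^ card F)"
    using finD by (simp only: sum.inter_filter finite_Pow_iff)
  also have "\<dots> = (\<Sum>F\<in>?C. of_bool (even (card F)) - of_bool (odd (card F)))"
    by (intro sum.cong refl) (simp add: minus_one_power_iff)
  also have "\<dots> = int (card {F \<in> ?C. even (card F)}) - int (card {F \<in> ?C. odd (card F)})"
    using finC by (simp add: sum_subtractf of_bool_def flip: sum.inter_filter)
  finally show ?thesis by (simp add: card)
qed

text \<open>The orientation enters the \<open>LEAST\<close> with the value
  \<open>max_in_degree G' + 1\<close>; as there are vertices, the \<open>Max\<close> is taken over a
  nonempty set.\<close>

lemma AT_le:
  assumes fin: "finite (pverts G)" "pverts G \<noteq> {}" and G: "parcs G \<subseteq> pverts G \<times> pverts G"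
    and orient: "AT_orientable (pverts G) (parcs G) (\<lambda>_. b)"
  shows "AT G \<le> b + 1"
proof -
  obtain D where D: "D \<union> D\<inverse> = parcs G \<inter> pverts G \<times> pverts G" "D \<inter> D\<inverse> = {}"
    "flow_count (pverts G) D (\<lambda>_. 0) \<noteq> 0" "\<forall>v\<in>pverts G. card {u. (u, v) \<in> D} \<le> b"
    using orient unfolding AT_orientable_def by blast
  have DV: "D \<subseteq> pverts G \<times> pverts G" using D(1) by blast
  define G' where "G' = \<lparr>pverts = pverts G, parcs = D\<rparr>"
  have "orientation G' G" using D(1,2) G by (simp add: orientation_def G'_def Int_absorb2)
  moreover have "card (even_circulations G') \<noteq> card (odd_circulations G')"
    using D(3) flow_count_circulations[OF fin(1) DV] by (simp add: G'_def)
  ultimately have "AT G \<le> max_in_degree G' + 1" unfolding AT_def by (intro Least_le) blast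
  moreover have "max_in_degree G' \<le> b"
    unfolding max_in_degree_def using fin D(4) by (simp add: G'_def in_degree_with_proj)
  ultimately show ?thesis by simp
qed

section \<open>Induced odd cycles and complete graphs\<close>

lemma odd_cycle_graphE:
  assumes "odd_cycle_graph (with_proj G \<restriction> T)"
  obtains vs where "distinct vs" "3 \<le> length vs" "odd (length vs)" "set vs = T"
    "parcs G \<inter> T \<times> T = set (vwalk_arcs (vs @ [hd vs])) \<union> (set (vwalk_arcs (vs @ [hd vs])))\<inverse>"
proof -
  have "arcs_ends (with_proj G \<restriction> T) = parcs G \<inter> T \<times> T"
    by (auto simp: arcs_ends_conv induce_subgraph_def)
  then show ?thesis using assms that unfolding odd_cycle_graph_def Let_def by auto
qed

lemma complete_graph_iff:
  assumes "complete_graph (with_proj G \<restriction> T)" "u \<in> T" "v \<in> T"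
  shows "(u, v) \<in> parcs G \<longleftrightarrow> u \<noteq> v"
proof -
  have "arcs_ends (with_proj G \<restriction> T) = {(u, v). (u, v) \<in> T \<times> T \<and> u \<noteq> v}"
    using assms(1) by (auto simp: complete_graph_def complete_digraph_def)
  moreover have "(u, v) \<in> arcs_ends (with_proj G \<restriction> T) \<longleftrightarrow> (u, v) \<in> parcs G"
    using assms(2,3) by (force simp: arcs_ends_conv induce_subgraph_def)
  ultimately show ?thesis using assms(2,3) by simp
qed

lemma cycle_degree:
  assumes "distinct vs" "3 \<le> length vs" and v: "v \<in> set vs"
    and EG: "EG \<inter> set vs \<times> set vs =
      set (vwalk_arcs (vs @ [hd vs])) \<union> (set (vwalk_arcs (vs @ [hd vs])))\<inverse>"
  shows "card {u \<in> set vs. (u, v) \<in> EG} \<le> 2"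
proof -
  interpret directed_cycle vs using assms by unfold_locales
  note EG = EG[folded P_def]
  have "{u \<in> set vs. (u, v) \<in> EG} = {u. (u, v) \<in> P} \<union> {u. (v, u) \<in> P}"
    using EG v P_subset by blast
  then have "card {u \<in> set vs. (u, v) \<in> EG} \<le> card {u. (u, v) \<in> P} + card {u. (v, u) \<in> P}"
    by (simp only: card_Un_le)
  then show ?thesis using in_degree_P[OF v] out_degree_P[OF v] by simp
qed

theorem theorem9:
  fixes G :: "'a pair_pre_digraph" and H :: "'b pair_pre_digraph"
    and S :: "nat \<Rightarrow> 'a set" and \<rho> :: "nat \<Rightarrow> nat" and m k \<alpha> :: nat and ws :: "'b list"
  assumes G: "pair_graph G"
    and m: "1 \<le> m"
    and partition: "partition_on (pverts G) (S ` {1..m})" "inj_on S {1..m}"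
    and card_S: "\<And>i. i \<in> {1..m} \<Longrightarrow> 3 \<le> card (S i)"
    and S: "\<And>i. i \<in> {1..m} \<Longrightarrow>
      odd_cycle_graph (with_proj G \<restriction> S i) \<or> complete_graph (with_proj G \<restriction> S i)"
    and \<rho>_1: "\<rho> 1 = 0"
    and \<rho>: "\<And>i v. i \<in> {2..m} \<Longrightarrow> v \<in> S i \<Longrightarrow>
      card (neighborhood G v \<inter> (\<Union>j\<in>{1..i-1}. S j)) \<le> \<rho> i"
    and \<alpha>: "\<alpha> = (MAX i\<in>{1..m}.
      if odd_cycle_graph (with_proj G \<restriction> S i) then \<rho> i + 3 else \<rho> i + card (S i))"
    and H: "pair_graph H" "2 \<le> card (pverts H)"
    and hamilton: "hamilton_path ws H"
    and k: "\<And>i. i < length ws \<Longrightarrow> card (neighborhood H (ws ! i) \<inter> set (take i ws)) \<le> k"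
  shows "AT G \<le> \<alpha> \<and> AT (G \<box> H) \<le> \<alpha> + k - 1"
proof -
  interpret G: pair_graph G by (rule G)
  interpret H: pair_graph H by (rule H(1))
  have EG: "sym (parcs G)" "irrefl (parcs G)"
    using G.arcs_symmetric G.no_loops' by (auto intro: symI simp: irrefl_def)
  have EH: "sym (parcs H)" "irrefl (parcs H)"
    using H.arcs_symmetric H.no_loops' by (auto intro: symI simp: irrefl_def)
  have ws: "distinct ws" "set (vwalk_arcs ws) \<subseteq> parcs H" "set ws = pverts H"
    using hamilton by (auto simp: hamilton_path_def vpath_def vwalk_def)
  interpret ham: hamiltonian_order "parcs H" ws k
  proof
    show "2 \<le> length ws" using H(2) distinct_card[OF ws(1)] ws(3) by simp
    show "(ws ! i, ws ! Suc i) \<in> parcs H" if "Suc i < length ws" for i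
      using ws(2) that unfolding set_vwalk_arcs by blast
    have "neighborhood H v \<inter> A = {w \<in> A. (w, v) \<in> parcs H}" for v A
      by (auto simp: neighborhood_def)
    with k show "card {w \<in> set (take i ws). (w, ws ! i) \<in> parcs H} \<le> k" if "i < length ws" for i
      using that by simp
  qed (fact EH ws(1))+
  have VG: "pverts G = (\<Union>i\<in>{1..m}. S i)" using partition_onD1[OF partition(1)] by simp
  have disj: "i = j" if "i \<in> {1..m}" "j \<in> {1..m}" "u \<in> S i" "u \<in> S j" for i j u
  proof -
    have "S i = S j"
      using disjointD[OF partition_onD2[OF partition(1)], of "S i" "S j"] that by blast
    then show ?thesis using inj_onD[OF partition(2)] that by blast
  qed
  define part where "part u = (THE i. i \<in> {1..m} \<and> u \<in> S i)" for u
  have part: "part u = i" if "i \<in> {1..m}" "u \<in> S i" for i u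
    unfolding part_def using that disj by blast
  have partI: "part u \<in> {1..m}" "u \<in> S (part u)" if "u \<in> pverts G" for u
    using that part VG by auto
  have fiber: "{u \<in> pverts G. part u = i} = S i" if "i \<in> {1..m}" for i
    using that part partI VG by auto
  have finS: "finite (S i)" if "i \<in> {1..m}" for i
    using card_S[OF that] card.infinite by fastforce
  \<comment> \<open>The assumption on \<open>\<rho>\<close> starts at index 2; vertices of the first
    block have no neighbour in a block of lower index.\<close>
  have earlier: "card {u \<in> pverts G. (u, v) \<in> parcs G \<and> part u < part v} \<le> \<rho> (part v)"
    if v: "v \<in> pverts G" for v
  proof (cases "part v = 1")
    case True
    then have none: "{u \<in> pverts G. (u, v) \<in> parcs G \<and> part u < part v} = {}"
      using partI(1) by fastforce
    show ?thesis unfolding none by simp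
  next
    case False
    then have i: "part v \<in> {2..m}" using partI(1)[OF v] by auto
    have "{u \<in> pverts G. (u, v) \<in> parcs G \<and> part u < part v} \<subseteq>
        neighborhood G v \<inter> (\<Union>j\<in>{1..part v - 1}. S j)"
    proof
      fix u assume u: "u \<in> {u \<in> pverts G. (u, v) \<in> parcs G \<and> part u < part v}"
      then have "part u \<in> {1..part v - 1}" "u \<in> S (part u)" using partI[of u] by auto
      then show "u \<in> neighborhood G v \<inter> (\<Union>j\<in>{1..part v - 1}. S j)"
        using u by (auto simp: neighborhood_def)
    qed
    moreover have "finite (neighborhood G v)"
      by (rule finite_subset[OF _ G.pair_finite_verts]) (auto simp: neighborhood_def dest: G.in_arcsD1)
    ultimately have "card {u \<in> pverts G. (u, v) \<in> parcs G \<and> part u < part v} \<le>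
        card (neighborhood G v \<inter> (\<Union>j\<in>{1..part v - 1}. S j))" by (intro card_mono) auto
    then show ?thesis using \<rho>[OF i partI(2)[OF v]] by simp
  qed
  \<comment> \<open>The share of the block itself, so that \<open>\<alpha>\<close> is the maximum of
    \<open>\<rho> i + c i\<close>.\<close>
  define c where "c i = (if odd_cycle_graph (with_proj G \<restriction> S i) then 3 else card (S i))" for i
  have c3: "3 \<le> c i" if "i \<in> {1..m}" for i using card_S[OF that] by (simp add: c_def)
  have c_le: "\<rho> i + c i \<le> \<alpha>" if "i \<in> {1..m}" for i
    unfolding \<alpha> c_def using that by (intro Max_ge) (auto intro!: image_eqI[of _ _ i])
  have ne: "pverts G \<noteq> {}" using card_S[of 1] m VG by fastforce
  have \<alpha>3: "3 \<le> \<alpha>" using c3[of 1] c_le[of 1] m by simp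

  \<comment> \<open>Vertices are ranked by their block. Inside a block any order serves, because all
    degrees there are at most \<open>c i - 1\<close>: 2 on a cycle, \<open>card (S i) - 1\<close> in
    a complete graph.\<close>
  have "AT_orientable (pverts G) (parcs G) (\<lambda>_. \<alpha> - 1)"
  proof (rule AT_orientable_ranked[OF G.pair_finite_verts EG, of part "\<lambda>v. c (part v) - 1"])
    fix i assume "i \<in> part ` pverts G"
    then have i: "i \<in> {1..m}" using partI(1) by auto
    obtain r :: "'a \<Rightarrow> nat" where r: "inj_on r (S i)"
      using finite_imp_inj_to_nat_seg[OF finS[OF i]] by blast
    show "AT_orientable {v \<in> pverts G. part v = i} (parcs G) (\<lambda>v. c (part v) - 1)"
      unfolding fiber[OF i]
    proof (rule AT_orientable_degenerate[OF finS[OF i] EG r])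
      fix v assume v: "v \<in> S i"
      have "card {u \<in> S i. (u, v) \<in> parcs G \<and> r u < r v} \<le> card {u \<in> S i. (u, v) \<in> parcs G}"
        using finS[OF i] by (intro card_mono) auto
      also have "\<dots> \<le> c i - 1"
      proof (cases "odd_cycle_graph (with_proj G \<restriction> S i)")
        case True
        from True obtain vs where "distinct vs" "3 \<le> length vs" "odd (length vs)" "set vs = S i"
          "parcs G \<inter> S i \<times> S i = set (vwalk_arcs (vs @ [hd vs])) \<union> (set (vwalk_arcs (vs @ [hd vs])))\<inverse>"
          by (rule odd_cycle_graphE)
        then show ?thesis using cycle_degree[of vs v "parcs G"] v True by (simp add: c_def)
      next
        case False
        then have "{u \<in> S i. (u, v) \<in> parcs G} = S i - {v}"
          using S[OF i] complete_graph_iff[of G "S i"] v by auto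
        then show ?thesis using v finS[OF i] False by (simp add: c_def)
      qed
      finally show "card {u \<in> S i. (u, v) \<in> parcs G \<and> r u < r v} \<le> c (part v) - 1"
        using part[OF i v] by simp
    qed
  next
    fix v assume v: "v \<in> pverts G"
    show "c (part v) - 1 + card {u \<in> pverts G. (u, v) \<in> parcs G \<and> part u < part v} \<le> \<alpha> - 1"
      using earlier[OF v] c_le[OF partI(1)[OF v]] c3[OF partI(1)[OF v]] by linarith
  qed
  then have "AT G \<le> \<alpha> - 1 + 1"
    by (intro AT_le G.pair_finite_verts ne) (auto dest: G.in_arcsD1 G.in_arcsD2)
  then have AT_G: "AT G \<le> \<alpha>" using \<alpha>3 by simp

  let ?V = "pverts G \<times> set ws" and ?E = "product_arcs (parcs G) (parcs H)"
  \<comment> \<open>The rank is the block of the first coordinate. Edges that change only the second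
    coordinate stay in a fiber, so again at most \<open>\<rho>\<close> neighbours have lower rank.
    For an odd cycle \<open>c i + k - 2\<close> is \<open>k + 1\<close>.\<close>
  have "AT_orientable ?V ?E (\<lambda>_. \<alpha> + k - 2)"
  proof (rule AT_orientable_ranked[OF _ ham.sym_irrefl_product[OF EG],
        of _ "\<lambda>p. part (fst p)" "\<lambda>p. c (part (fst p)) + k - 2"])
    fix i assume "i \<in> (\<lambda>p. part (fst p)) ` ?V"
    then have i: "i \<in> {1..m}" using partI(1) by auto
    have fib: "{p \<in> ?V. part (fst p) = i} = S i \<times> set ws"
      unfolding fiber[OF i, symmetric] by auto
    have "AT_orientable (S i \<times> set ws) ?E (\<lambda>_. c i + k - 2)"
    proof (cases "odd_cycle_graph (with_proj G \<restriction> S i)")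
      case True
      from True obtain vs where vs: "distinct vs" "3 \<le> length vs" "odd (length vs)" "set vs = S i"
        "parcs G \<inter> S i \<times> S i = set (vwalk_arcs (vs @ [hd vs])) \<union> (set (vwalk_arcs (vs @ [hd vs])))\<inverse>"
        by (rule odd_cycle_graphE)
      then have "AT_orientable (set vs \<times> set ws) ?E (\<lambda>_. k + 1)"
        by (intro ham.AT_orientable_odd_cycle_product) simp_all
      then show ?thesis unfolding vs(4) by (rule AT_orientable_mono) (simp add: c_def True)
    next
      case False
      then have "AT_orientable (S i \<times> set ws) ?E (\<lambda>_. card (S i) + k - 2)"
        using S[OF i] complete_graph_iff[of G "S i"]
        by (intro ham.AT_orientable_complete_product EG finS[OF i] card_S[OF i]) auto
      then show ?thesis using False by (simp add: c_def)
    qed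
    then show "AT_orientable {p \<in> ?V. part (fst p) = i} ?E (\<lambda>p. c (part (fst p)) + k - 2)"
      unfolding fib by (rule AT_orientable_mono) (use part[OF i] in auto)
  next
    fix q assume q: "q \<in> ?V"
    obtain v w where vw: "q = (v, w)" "v \<in> pverts G" using q by auto
    let ?X = "{p \<in> ?V. (p, q) \<in> ?E \<and> part (fst p) < part (fst q)}"
    let ?Y = "{u \<in> pverts G. (u, v) \<in> parcs G \<and> part u < part v}"
    have "?X \<subseteq> (\<lambda>u. (u, w)) ` ?Y" by (auto simp: vw)
    then have "card ?X \<le> card ((\<lambda>u. (u, w)) ` ?Y)"
      by (rule card_mono[rotated]) simp
    also have "\<dots> \<le> card ?Y" by (rule card_image_le) simp
    also have "\<dots> \<le> \<rho> (part v)" by (rule earlier[OF vw(2)])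
    finally have "card ?X \<le> \<rho> (part v)" .
    moreover have "\<rho> (part v) + c (part v) \<le> \<alpha>" "3 \<le> c (part v)"
      using c_le c3 partI(1)[OF vw(2)] by blast+
    ultimately show "c (part (fst q)) + k - 2 + card ?X \<le> \<alpha> + k - 2"
      unfolding vw(1) fst_conv by linarith
  qed simp
  moreover have "pverts (G \<box> H) = ?V" "parcs (G \<box> H) = ?E \<inter> ?V \<times> ?V"
    by (auto simp: cartesian_product_def ws(3))
  ultimately have "AT_orientable (pverts (G \<box> H)) (parcs (G \<box> H)) (\<lambda>_. \<alpha> + k - 2)"
    unfolding AT_orientable_def by (simp add: Int_absorb2)
  then have "AT (G \<box> H) \<le> \<alpha> + k - 2 + 1"
    by (rule AT_le[rotated 3]) (use ne ws(3) H(2) in \<open>auto simp: cartesian_product_def\<close>)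
  \<comment> \<open>Subtraction is truncated here; \<open>3 \<le> \<alpha>\<close> makes
    \<open>\<alpha> + k - 2 + 1\<close> equal to \<open>\<alpha> + k - 1\<close>.\<close>
  then have "AT (G \<box> H) \<le> \<alpha> + k - 1" using \<alpha>3 by simp
  with AT_G show ?thesis by simp
qed

end
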